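(* Let $n\ge 1$ and let $s_1,\dots,s_n$ be $n$ integers such that $s_i\not\equiv s_j \pmod n$ whenever $i\ne j$ and $\sum_{j=1}^n s_j\neq 0$. For every invertible matrix $M\in\mathbb{C}^{n\times n}$ there are $A_i,A'_i\in\mathrm{Vand}_{s_i}$ and $B_i,B'_i\in\mathrm{Vand}_{s_i}^{\mathsf T}$, $i=1,\dots,n$, such that \[ M=B_1A_1\cdots B_nA_n\,B'_1A'_1\cdots B'_nA'_n . \] For every matrix $M\in\mathbb{C}^{n\times n}$ there are $A_i,A'_i,C_i,C'_i\in\mathrm{Vand}_{s_i}$ and $B_i,B'_i,D_i,D'_i\in\mathrm{Vand}_{s_i}^{\mathsf T}$, $i=1,\dots,n$, and a diagonal matrix $E$ such that \[ M=B_1A_1\cdots B_nA_n\,B'_1A'_1\cdots B'_nA'_n\,E\,D_1C_1\cdots D_nC_n\,D'_1C'_1\cdots D'_nC'_n . \]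
   Context: For an integer $s$, a generalized Vandermonde matrix of type $s$ is an $n\times n$ matrix whose $(p,q)$ entry is $x_q^{s+p-1}$, $1\le p,q\le n$, for some $x_1,\dots,x_n\in\mathbb{C}$ (for which these powers are defined, i.e. nonzero when a negative exponent occurs). $\mathrm{Vand}_s$ denotes the set of all generalized Vandermonde matrices of type $s$, and $\mathrm{Vand}_s^{\mathsf T}$ the set of their transposes. *)

theory Defs
  imports "Jordan_Normal_Form.Matrix" "HOL-Number_Theory.Cong" Complex_Main
begin

text \<open>Row and column indices start at 0, so the entry x_q ^ (s + p - 1) at the 1-based position
  (p, q) appears here with exponent s + p. As 0 powi 0 = 1, a node may be 0 exactly when no
  exponent is negative, and the exponent 0 then gives the usual Vandermonde entry 1.\<close>

definition gen_vandermonde :: "nat \<Rightarrow> int \<Rightarrow> (nat \<Rightarrow> complex) \<Rightarrow> complex mat" where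
  "gen_vandermonde n s x = mat n n (\<lambda>(p, q). x q powi (s + int p))"

definition Vand :: "nat \<Rightarrow> int \<Rightarrow> complex mat set" where
  "Vand n s = {gen_vandermonde n s x | x. \<forall>p<n. \<forall>q<n. s + int p < 0 \<longrightarrow> x q \<noteq> 0}"

definition VandT :: "nat \<Rightarrow> int \<Rightarrow> complex mat set" where
  "VandT n s = transpose_mat ` Vand n s"

text \<open>The ordered product B_0 A_0 B_1 A_1 ... B_{n-1} A_{n-1} of n by n matrices.\<close>

definition alt_prod :: "nat \<Rightarrow> (nat \<Rightarrow> complex mat) \<Rightarrow> (nat \<Rightarrow> complex mat) \<Rightarrow> complex mat" where
  "alt_prod n B A = foldr (*) (map (\<lambda>i. B i * A i) [0..<n]) (1\<^sub>m n)"

end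

theory Submission
  imports
    Defs
    "Jordan_Normal_Form.Determinant"
    "HOL-Computational_Algebra.Fundamental_Theorem_Algebra"
begin

text \<open>Fix the types s and let \<Phi> map the nodes y, x to the product B_0 A_0 ... B_{n-1} A_{n-1}. The
claim about invertible matrices follows once the image of \<Phi> contains every matrix at which some
nonzero polynomial function f of the matrix entries does not vanish. Indeed two nonempty open sets
of the Zariski topology meet: for an invertible M some X satisfies both f(X) \<noteq> 0 and
f(X\<inverse> M) \<noteq> 0, and then M = X (X\<inverse> M) is a product of two elements of the image
(invertible_product_of_generic). An arbitrary M equals P E Q with P, Q invertible and E diagonal
(equiv_mat_diagonal), which gives the second claim.

That the image contains such a generic set is shown in two steps. The image is constructible, by
elimination of the nodes one at a time (constructible_Ex_finite), so it either contains a nonempty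
set {f \<noteq> 0} or is disjoint from one (constructible_generic). The second alternative is refuted at a
single point: if for every matrix Z there are curves in the image of the form
c I + \<epsilon>^2 Z + o(\<epsilon>^2), with the fixed scalar c = n^n, then a polynomial function vanishing on the
image has all its homogeneous parts at c I equal to zero (polyfun_vanish_on_curves).

The point is the one at which all nodes are n-th roots of unity, with the nodes of B_i inverse to
those of A_i. There each B_i A_i is n times the identity, whatever the type s_i. Moving the nodes by
exponential factors, as in vand_prod_expansion, changes entry (p, q) of B_i A_i / n to first order
in proportion to (u i p + v i q) m_i(q - p), where the circulant coefficients m_i(d) are, for d not divisible by
n, equal to \<omega>^(d s_i) / (\<omega>^d - 1), and m_i(0) = s_i + (n - 1) / 2. As the s_i represent every
residue modulo n once, orthogonality of characters prescribes all off-diagonal entries of the sum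
over i. The diagonal ones are also attained provided \<kappa> = \<Sum> m_i(0) is nonzero
(linear_image_all).

If \<kappa> = 0, the attained first-order variations are exactly a hyperplane \<Lambda> = 0
(linear_image_kernel is the inclusion that matters). Then the second-order term supplies the
missing direction. Moving the nodes in the same way for all i does not change the product to first
order, because \<Sum> m_i(d) = 0 for all d, so the quadratic term Q is the leading one along such
curves; and polarizing \<Lambda> \<circ> Q at the indicators of p = 0 and q = d gives
- |\<tau> d|^2 / n, where \<tau> is a Fourier transform of the values m_i(0). These
values are distinct, so \<tau> d is nonzero for some d not divisible by n as soon as n \<ge> 2
(exists_quadratic_transversal). For n = 1 the number \<kappa> is s_0, which is nonzero by hypothesis.\<close>

section \<open>Polynomial functions\<close>

text \<open>Polynomials in the variables v are represented by the functions on assignments e that they define;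
over the complex numbers nothing is lost, and substitution is composition.\<close>

inductive_set polyfuns :: "(('v \<Rightarrow> complex) \<Rightarrow> complex) set" where
  polyfun_const: "(\<lambda>e. c) \<in> polyfuns"
| polyfun_var: "(\<lambda>e. e v) \<in> polyfuns"
| polyfun_add: "f \<in> polyfuns \<Longrightarrow> g \<in> polyfuns \<Longrightarrow> (\<lambda>e. f e + g e) \<in> polyfuns"
| polyfun_mult: "f \<in> polyfuns \<Longrightarrow> g \<in> polyfuns \<Longrightarrow> (\<lambda>e. f e * g e) \<in> polyfuns"

lemma polyfun_uminus: "f \<in> polyfuns \<Longrightarrow> (\<lambda>e. - f e) \<in> polyfuns"
  using polyfun_mult[OF polyfun_const[of "-1"], of f] by simp

lemma polyfun_diff: "f \<in> polyfuns \<Longrightarrow> g \<in> polyfuns \<Longrightarrow> (\<lambda>e. f e - g e) \<in> polyfuns"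
  using polyfun_add[OF _ polyfun_uminus, of f g] by simp

lemma polyfun_sum: "(\<And>i. i \<in> I \<Longrightarrow> f i \<in> polyfuns) \<Longrightarrow> (\<lambda>e. \<Sum>i\<in>I. f i e) \<in> polyfuns"
  by (induction I rule: infinite_finite_induct) (auto intro: polyfuns.intros)

lemma polyfun_prod: "(\<And>i. i \<in> I \<Longrightarrow> f i \<in> polyfuns) \<Longrightarrow> (\<lambda>e. \<Prod>i\<in>I. f i e) \<in> polyfuns"
  by (induction I rule: infinite_finite_induct) (auto intro: polyfuns.intros)

lemma polyfun_power: "f \<in> polyfuns \<Longrightarrow> (\<lambda>e. f e ^ k) \<in> polyfuns"
  by (induction k) (auto intro: polyfuns.intros)

lemma polyfun_subst:
  assumes "f \<in> polyfuns" "\<And>v. (\<lambda>e. s e v) \<in> polyfuns"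
  shows "(\<lambda>e. f (s e)) \<in> polyfuns"
  using assms(1) by induction (auto intro: polyfuns.intros assms(2))

lemma polyfun_tendsto:
  assumes "f \<in> polyfuns" "\<And>v. ((\<lambda>t. h t v) \<longlongrightarrow> l v) F"
  shows "((\<lambda>t. f (h t)) \<longlongrightarrow> f l) F"
  using assms(1) by induction (auto intro: tendsto_intros assms(2))

lemma polyfun_det:
  assumes "\<And>e. A e \<in> carrier_mat n n"
    and "\<And>i j. i < n \<Longrightarrow> j < n \<Longrightarrow> (\<lambda>e. A e $$ (i, j)) \<in> polyfuns"
  shows "(\<lambda>e. det (A e)) \<in> polyfuns"
proof -
  have "(\<lambda>e. det (A e)) =
      (\<lambda>e. \<Sum>p\<in>{p. p permutes {0..<n}}. signof p * (\<Prod>i\<in>{0..<n}. A e $$ (i, p i)))"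
    using det_def'[OF assms(1)] by auto
  moreover have "\<dots> \<in> polyfuns"
    by (intro polyfun_sum polyfun_mult polyfun_const polyfun_prod assms(2)) (auto simp: permutes_in_image dest: permutes_in_image)
  ultimately show ?thesis by simp
qed

text \<open>Restriction to a line is what replaces the degree theory of polynomials in several variables: it
reduces, for instance, the absence of zero divisors to the case of one variable.\<close>

lemma polyfun_along_line:
  assumes "f \<in> polyfuns"
  shows "\<exists>p. \<forall>t. f (\<lambda>v. a v + t * b v) = poly p t"
  using assms
proof induction
    case (polyfun_const c) show ?case by (rule exI[of _ "[:c:]"]) simp
  next
    case (polyfun_var v) show ?case by (rule exI[of _ "[:a v, b v:]"]) simp
  next
    case (polyfun_add f g)
    then obtain p q where "\<And>t. f (\<lambda>v. a v + t * b v) = poly p t" "\<And>t. g (\<lambda>v. a v + t * b v) = poly q t"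
      by blast
    then show ?case by (intro exI[of _ "p + q"]) simp
  next
    case (polyfun_mult f g)
    then obtain p q where "\<And>t. f (\<lambda>v. a v + t * b v) = poly p t" "\<And>t. g (\<lambda>v. a v + t * b v) = poly q t"
      by blast
    then show ?case by (intro exI[of _ "p * q"]) simp
qed

lemma poly_avoid_roots:
  fixes p :: "complex poly" assumes "p \<noteq> 0" shows "\<exists>t. poly p t \<noteq> 0"
  using assms poly_all_0_iff_0 by blast

text \<open>On the line through a point where f is nonzero and a point where g is nonzero both restrict to
nonzero polynomials in one variable, and so does their product.\<close>

lemma polyfun_mult_nonzero:
  assumes "f \<in> polyfuns" "g \<in> polyfuns" "f a \<noteq> 0" "g b \<noteq> 0"
  shows "\<exists>e. f e * g e \<noteq> 0"
proof -
  obtain p where p: "\<And>t. f (\<lambda>v. a v + t * (b v - a v)) = poly p t" using polyfun_along_line[OF assms(1), of a "\<lambda>v. b v - a v"] by blast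
  obtain q where q: "\<And>t. g (\<lambda>v. a v + t * (b v - a v)) = poly q t" using polyfun_along_line[OF assms(2), of a "\<lambda>v. b v - a v"] by blast
  have "poly p 0 \<noteq> 0" using p[of 0] assms(3) by simp
  moreover have "poly q 1 \<noteq> 0" using q[of 1] assms(4) by simp
  ultimately have "p * q \<noteq> 0" by auto
  then obtain t where "poly (p * q) t \<noteq> 0" using poly_avoid_roots by blast
  then show ?thesis using p[of t] q[of t]
    by (intro exI[of _ "\<lambda>v. a v + t * (b v - a v)"]) simp
qed

section \<open>Elimination of quantifiers\<close>

text \<open>A polynomial in one distinguished variable whose coefficients are polynomial functions of the
parameters e. The number d bounds the number of coefficients formally, uniformly in e; the actual
degree may drop at special parameters. With d = 0 the family is zero.\<close>

definition poly_family :: "nat \<Rightarrow> (('v \<Rightarrow> complex) \<Rightarrow> complex poly) \<Rightarrow> bool" where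
  "poly_family d P \<longleftrightarrow> (\<forall>i. (\<lambda>e. coeff (P e) i) \<in> polyfuns) \<and> (\<forall>e i. d \<le> i \<longrightarrow> coeff (P e) i = 0)"

lemma poly_family_coeff: "poly_family d P \<Longrightarrow> (\<lambda>e. coeff (P e) i) \<in> polyfuns"
  by (auto simp: poly_family_def)

lemma poly_family_mono: "poly_family d P \<Longrightarrow> d \<le> d' \<Longrightarrow> poly_family d' P"
  by (auto simp: poly_family_def)

lemma poly_family_0: "poly_family 0 P \<longleftrightarrow> P = (\<lambda>e. 0)"
  by (auto simp: poly_family_def fun_eq_iff poly_eq_iff polyfun_const)

lemma poly_family_monom:
  assumes "f \<in> polyfuns" shows "poly_family (Suc k) (\<lambda>e. monom (f e) k)"
  unfolding poly_family_def
proof (intro conjI allI impI)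
  show "(\<lambda>e. coeff (monom (f e) k) i) \<in> polyfuns" for i
    using assms by (cases "i = k") (simp_all add: polyfun_const)
qed simp

lemma poly_family_add: "poly_family d P \<Longrightarrow> poly_family d' Q \<Longrightarrow> poly_family (max d d') (\<lambda>e. P e + Q e)"
  by (auto simp: poly_family_def intro: polyfun_add)

lemma poly_family_diff: "poly_family d P \<Longrightarrow> poly_family d' Q \<Longrightarrow> poly_family (max d d') (\<lambda>e. P e - Q e)"
  by (auto simp: poly_family_def intro: polyfun_diff)

lemma poly_family_smult: "f \<in> polyfuns \<Longrightarrow> poly_family d P \<Longrightarrow> poly_family d (\<lambda>e. smult (f e) (P e))"
  by (auto simp: poly_family_def intro: polyfun_mult)

lemma poly_family_mult:
  assumes "poly_family d P" "poly_family d' Q" shows "poly_family (d + d') (\<lambda>e. P e * Q e)"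
  unfolding poly_family_def
proof (intro conjI allI impI)
  show "(\<lambda>e. coeff (P e * Q e) i) \<in> polyfuns" for i
    unfolding coeff_mult by (intro polyfun_sum polyfun_mult poly_family_coeff[OF assms(1)] poly_family_coeff[OF assms(2)])
  fix e i assume i: "d + d' \<le> i"
  have "coeff (P e) j * coeff (Q e) (i - j) = 0" for j
    using assms i by (cases "d \<le> j") (auto simp: poly_family_def)
  then show "coeff (P e * Q e) i = 0" unfolding coeff_mult by (intro sum.neutral) blast
qed

lemma poly_family_power: "poly_family d P \<Longrightarrow> \<exists>d'. poly_family d' (\<lambda>e. P e ^ k)"
proof (induction k)
  case 0 show ?case using poly_family_monom[OF polyfun_const[of 1], of 0] by (auto simp: monom_0 pCons_one)
next
  case (Suc k) then show ?case using poly_family_mult by fastforce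
qed

text \<open>This views a polynomial function as a polynomial in one variable x after the other variables have
been replaced by polynomials in x.\<close>

lemma polyfun_subst_family:
  assumes "f \<in> polyfuns" "\<And>v. \<exists>d. poly_family d (S v)"
  shows "\<exists>d P. poly_family d P \<and> (\<forall>e x. f (\<lambda>v. poly (S v e) x) = poly (P e) x)"
  using assms(1)
proof induction
  case (polyfun_const c)
  show ?case using poly_family_monom[OF polyfuns.polyfun_const[of c], of 0]
    by (intro exI[of _ 1] exI[of _ "\<lambda>e. [:c:]"]) (auto simp: monom_0)
next
  case (polyfun_var v) then show ?case using assms(2) by blast
next
  case (polyfun_add f g)
  then obtain d P d' Q where *: "poly_family d P" "\<forall>e x. f (\<lambda>v. poly (S v e) x) = poly (P e) x"
     "poly_family d' Q" "\<forall>e x. g (\<lambda>v. poly (S v e) x) = poly (Q e) x" by blast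
  show ?case using poly_family_add[OF *(1,3)] *(2,4) by (intro exI[of _ "max d d'"] exI[of _ "\<lambda>e. P e + Q e"]) auto
next
  case (polyfun_mult f g)
  then obtain d P d' Q where *: "poly_family d P" "\<forall>e x. f (\<lambda>v. poly (S v e) x) = poly (P e) x"
     "poly_family d' Q" "\<forall>e x. g (\<lambda>v. poly (S v e) x) = poly (Q e) x" by blast
  show ?case using poly_family_mult[OF *(1,3)] *(2,4) by (intro exI[of _ "d + d'"] exI[of _ "\<lambda>e. P e * Q e"]) auto
qed

text \<open>Complements are left out: closure under finite unions and intersections is all that the
elimination below needs, and it keeps every set visibly a finite union of cells.\<close>

inductive_set constructible :: "('v \<Rightarrow> complex) set set" where
  cell: "finite fs \<Longrightarrow> fs \<subseteq> polyfuns \<Longrightarrow> g \<in> polyfuns \<Longrightarrow> {e. (\<forall>f\<in>fs. f e = 0) \<and> g e \<noteq> 0} \<in> constructible"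
| Un: "S \<in> constructible \<Longrightarrow> T \<in> constructible \<Longrightarrow> S \<union> T \<in> constructible"

lemma constructible_eq: "f \<in> polyfuns \<Longrightarrow> {e. f e = 0} \<in> constructible"
  using cell[of "{f}" "\<lambda>e. 1"] by (auto intro: polyfuns.intros)

lemma constructible_neq: "f \<in> polyfuns \<Longrightarrow> {e. f e \<noteq> 0} \<in> constructible"
  using cell[of "{}" f] by auto

lemma constructible_empty: "{} \<in> constructible"
  using constructible_neq[OF polyfun_const[of 0]] by simp

lemma constructible_UN: "finite I \<Longrightarrow> (\<And>i. i \<in> I \<Longrightarrow> S i \<in> constructible) \<Longrightarrow> (\<Union>i\<in>I. S i) \<in> constructible"
  by (induction I rule: finite_induct) (auto intro: constructible_empty constructible.Un)

lemma constructible_Int: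
  assumes "S \<in> constructible" "T \<in> constructible" shows "S \<inter> T \<in> constructible"
  using assms(1)
proof induction
  case (cell fs g)
  note c1 = cell
  show ?case using assms(2)
  proof induction
    case (cell fs' g')
    have "{e. (\<forall>f\<in>fs. f e = 0) \<and> g e \<noteq> 0} \<inter> {e. (\<forall>f\<in>fs'. f e = 0) \<and> g' e \<noteq> 0}
      = {e. (\<forall>f\<in>fs \<union> fs'. f e = 0) \<and> g e * g' e \<noteq> 0}" by auto
    also have "\<dots> \<in> constructible" using c1 cell by (intro constructible.cell) (auto intro: polyfun_mult)
    finally show ?case .
  next
    case (Un S T) then show ?case by (simp add: Int_Un_distrib constructible.Un)
  qed
next
  case (Un S T) then show ?case by (simp add: Int_Un_distrib2 constructible.Un)
qed

lemma constructible_INT: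
  "finite I \<Longrightarrow> (\<And>i. i \<in> I \<Longrightarrow> {e. P i e} \<in> constructible) \<Longrightarrow> {e. \<forall>i\<in>I. P i e} \<in> constructible"
proof (induction I rule: finite_induct)
  case empty then show ?case using constructible_eq[OF polyfun_const[of 0]] by simp
next
  case (insert i I)
  have "{e. \<forall>i\<in>insert i I. P i e} = {e. P i e} \<inter> {e. \<forall>i\<in>I. P i e}" by auto
  moreover have "\<dots> \<in> constructible" using insert by (intro constructible_Int) auto
  ultimately show ?case by simp
qed

lemma constructible_family_nonzero: assumes "poly_family d Q" shows "{e. Q e \<noteq> 0} \<in> constructible"
proof -
  have "{e. Q e \<noteq> 0} = (\<Union>i\<in>{..<d}. {e. coeff (Q e) i \<noteq> 0})"
  proof (intro Set.set_eqI iffI)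
    fix e assume "e \<in> {e. Q e \<noteq> 0}"
    then obtain i where i: "coeff (Q e) i \<noteq> 0" by (auto simp: poly_eq_iff)
    then have "i < d" using assms by (meson poly_family_def not_le)
    then show "e \<in> (\<Union>i\<in>{..<d}. {e. coeff (Q e) i \<noteq> 0})" using i by blast
  qed auto
  also have "\<dots> \<in> constructible" using assms by (intro constructible_UN constructible_neq poly_family_coeff[OF assms]) auto
  finally show ?thesis .
qed

text \<open>One step of division without fractions: it cancels the leading coefficient of Q against that of P,
at the price of multiplying Q by the leading coefficient of P.\<close>

lemma poly_family_cancel:
  assumes "poly_family (Suc d) P" "poly_family (Suc k) Q" "d \<le> k"
  shows "poly_family k (\<lambda>e. smult (coeff (P e) d) (Q e) - monom (coeff (Q e) k) (k - d) * P e)"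
proof -
  let ?R = "\<lambda>e. smult (coeff (P e) d) (Q e) - monom (coeff (Q e) k) (k - d) * P e"
  have "poly_family (max (Suc k) (Suc (k - d) + Suc d)) ?R"
    by (intro poly_family_diff poly_family_smult poly_family_mult poly_family_monom poly_family_coeff[OF assms(1)] poly_family_coeff[OF assms(2)] assms)
  then have "(\<lambda>e. coeff (?R e) i) \<in> polyfuns" for i by (rule poly_family_coeff)
  moreover have "coeff (?R e) i = 0" if "k \<le> i" for e i
  proof (cases "i = k")
    case True then show ?thesis using assms(3) by (simp add: coeff_monom_mult)
  next
    case False
    then have "coeff (Q e) i = 0" "coeff (P e) (i - (k - d)) = 0"
      using that assms by (auto simp: poly_family_def)
    then show ?thesis by (simp add: coeff_monom_mult)
  qed
  ultimately show ?thesis unfolding poly_family_def by blast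
qed

text \<open>Iterating the cancellation leaves a remainder with fewer coefficients than P. Divisibility by P is
not affected as long as the factors, powers of the leading coefficient of P, are nonzero.\<close>

lemma poly_family_pseudo_mod:
  assumes P: "poly_family (Suc d) P" and Q: "poly_family k Q"
  shows "\<exists>R. poly_family d R \<and> (\<forall>e. coeff (P e) d \<noteq> 0 \<longrightarrow> (P e dvd Q e \<longleftrightarrow> R e = 0))"
  using Q
proof (induction k arbitrary: Q)
  case 0
  then have "Q = (\<lambda>e. 0)" by (simp add: poly_family_0)
  then show ?case by (intro exI[of _ Q]) (auto simp: poly_family_def polyfun_const)
next
  case (Suc k)
  show ?case
  proof (cases "d \<le> k")
    case True
    let ?S = "\<lambda>e. smult (coeff (P e) d) (Q e) - monom (coeff (Q e) k) (k - d) * P e"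
    obtain R where R: "poly_family d R" "\<And>e. coeff (P e) d \<noteq> 0 \<Longrightarrow> (P e dvd ?S e \<longleftrightarrow> R e = 0)"
      using Suc.IH[OF poly_family_cancel[OF P Suc.prems True]] by blast
    have "P e dvd ?S e \<longleftrightarrow> P e dvd Q e" if "coeff (P e) d \<noteq> 0" for e
      using that by (simp add: dvd_diff_left_iff dvd_smult_iff)
    then show ?thesis using R by auto
  next
    case False
    have "P e dvd Q e \<longleftrightarrow> Q e = 0" if c: "coeff (P e) d \<noteq> 0" for e
    proof
      assume dv: "P e dvd Q e"
      show "Q e = 0"
      proof (rule ccontr)
        assume "Q e \<noteq> 0"
        then have "degree (P e) \<le> degree (Q e)" using dv dvd_imp_degree_le by blast
        moreover have "d \<le> degree (P e)" using c le_degree by blast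
        moreover have "degree (Q e) \<le> k" using Suc.prems
          by (intro degree_le) (auto simp: poly_family_def)
        ultimately show False using False by simp
      qed
    qed auto
    moreover have "poly_family d Q" using Suc.prems False by (auto intro: poly_family_mono)
    ultimately show ?thesis by blast
  qed
qed

text \<open>Where P has degree exactly d, every root of P is a root of Q if and only if P divides the d-th power
of Q, and this is a polynomial condition on the parameters through the pseudo-remainder.\<close>

lemma constructible_single_equation:
  assumes P: "poly_family (Suc d) P" and Q: "poly_family k Q"
  shows "{e. coeff (P e) d \<noteq> 0} \<inter> {e. \<exists>x. poly (P e) x = 0 \<and> poly (Q e) x \<noteq> 0} \<in> constructible"
proof -
  obtain k' where k': "poly_family k' (\<lambda>e. Q e ^ d)" using poly_family_power[OF Q] by (rule exE)
  obtain R where R: "poly_family d R" "\<And>e. coeff (P e) d \<noteq> 0 \<Longrightarrow> (P e dvd Q e ^ d \<longleftrightarrow> R e = 0)"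
    using poly_family_pseudo_mod[OF P k'] by blast
  have "(\<exists>x. poly (P e) x = 0 \<and> poly (Q e) x \<noteq> 0) \<longleftrightarrow> R e \<noteq> 0" if c: "coeff (P e) d \<noteq> 0" for e
  proof -
    have "degree (P e) = d" using c P
      by (metis antisym degree_le poly_family_def le_degree not_less_eq_eq not_less)
    then show ?thesis using nullstellensatz_univariate[of "P e" "Q e"] R(2)[OF c] c by auto
  qed
  then have "{e. coeff (P e) d \<noteq> 0} \<inter> {e. \<exists>x. poly (P e) x = 0 \<and> poly (Q e) x \<noteq> 0}
    = {e. coeff (P e) d \<noteq> 0} \<inter> {e. R e \<noteq> 0}" by auto
  also have "\<dots> \<in> constructible"
    by (intro constructible_Int constructible_neq poly_family_coeff[OF P] constructible_family_nonzero[OF R(1)])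
  finally show ?thesis .
qed

text \<open>The parameters for which a system of equations P = 0 and one inequation Q \<noteq> 0 in one unknown
has a solution. Each equation carries its formal number of coefficients, which drives the induction.\<close>

definition solvable_params :: "(nat \<times> (('v \<Rightarrow> complex) \<Rightarrow> complex poly)) list
    \<Rightarrow> (('v \<Rightarrow> complex) \<Rightarrow> complex poly) \<Rightarrow> ('v \<Rightarrow> complex) set" where
  "solvable_params dps Q = {e. \<exists>x. (\<forall>(d, P) \<in> set dps. poly (P e) x = 0) \<and> poly (Q e) x \<noteq> 0}"

lemma solvable_params_drop_leading:
  "{e. coeff (P e) d = 0} \<inter> solvable_params ((Suc d, P) # dps) Q
       = {e. coeff (P e) d = 0} \<inter> solvable_params ((d, \<lambda>e. P e - monom (coeff (P e) d) d) # dps) Q"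
  unfolding solvable_params_def by auto

lemma poly_family_drop_leading:
  assumes "poly_family (Suc d) P" shows "poly_family d (\<lambda>e. P e - monom (coeff (P e) d) d)"
proof -
  have "poly_family (max (Suc d) (Suc d)) (\<lambda>e. P e - monom (coeff (P e) d) d)"
    by (intro poly_family_diff poly_family_monom poly_family_coeff[OF assms] assms)
  then have "(\<lambda>e. coeff (P e - monom (coeff (P e) d) d) i) \<in> polyfuns" for i by (rule poly_family_coeff)
  moreover have "coeff (P e - monom (coeff (P e) d) d) i = 0" if "d \<le> i" for e i
    using that assms by (cases "i = d") (auto simp: poly_family_def coeff_monom)
  ultimately show ?thesis unfolding poly_family_def by blast
qed

text \<open>Induction on the total number of formal coefficients. Where the leading coefficient of the shorter of
two equations vanishes, that equation gets shorter; where it does not vanish, it is used to shorten the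
other one. This ends with at most one equation, whose leading coefficient is nonzero.\<close>

lemma constructible_solvable_params:
  assumes "\<forall>(d, P) \<in> set dps. poly_family d P" "poly_family k Q"
  shows "solvable_params dps Q \<in> constructible"
  using assms(1)
proof (induction "\<Sum>(d, P) \<leftarrow> dps. Suc d" arbitrary: dps rule: less_induct)
  case less
  note IH = less.hyps and fams = less.prems
  \<comment> \<open>It suffices to treat the parameters at which the first leading coefficient is nonzero.\<close>
  have split: "solvable_params L Q \<in> constructible"
    if L: "L = (Suc d, P) # M" "(\<Sum>(d, P) \<leftarrow> L. Suc d) = (\<Sum>(d, P) \<leftarrow> dps. Suc d)"
      "\<forall>(d, P) \<in> set L. poly_family d P" and gen: "{e. coeff (P e) d \<noteq> 0} \<inter> solvable_params L Q \<in> constructible"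
    for L d P M
  proof -
    have P: "poly_family (Suc d) P" using L by auto
    have "solvable_params L Q = {e. coeff (P e) d = 0} \<inter> solvable_params L Q \<union> {e. coeff (P e) d \<noteq> 0} \<inter> solvable_params L Q"
      by blast
    also have "{e. coeff (P e) d = 0} \<inter> solvable_params L Q = {e. coeff (P e) d = 0} \<inter>
        solvable_params ((d, \<lambda>e. P e - monom (coeff (P e) d) d) # M) Q"
      unfolding L(1) by (rule solvable_params_drop_leading)
    finally have eq: "solvable_params L Q = {e. coeff (P e) d = 0} \<inter>
        solvable_params ((d, \<lambda>e. P e - monom (coeff (P e) d) d) # M) Q
        \<union> {e. coeff (P e) d \<noteq> 0} \<inter> solvable_params L Q" .
    have "solvable_params ((d, \<lambda>e. P e - monom (coeff (P e) d) d) # M) Q \<in> constructible"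
      using L poly_family_drop_leading[OF P] by (intro IH) auto
    then have "{e. coeff (P e) d = 0} \<inter>
        solvable_params ((d, \<lambda>e. P e - monom (coeff (P e) d) d) # M) Q \<in> constructible"
      by (rule constructible_Int[OF constructible_eq[OF poly_family_coeff[OF P]]])
    then show ?thesis by (subst eq) (rule constructible.Un[OF _ gen])
  qed
  show ?case
  proof (cases dps)
    case Nil
    have "solvable_params dps Q = {e. Q e \<noteq> 0}"
      unfolding Nil solvable_params_def using poly_all_0_iff_0 by auto
    then show ?thesis using constructible_family_nonzero[OF assms(2)] by simp
  next
    case (Cons a dps')
    obtain d1 P1 where a: "a = (d1, P1)" by force
    show ?thesis
    proof (cases dps')
      case Nil
      show ?thesis
      proof (cases d1)
        case 0
        then have "P1 = (\<lambda>e. 0)" using fams Cons a poly_family_0 by auto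
        then have eq: "solvable_params dps Q = solvable_params [] Q" using Cons Nil a by (auto simp: solvable_params_def)
        have "solvable_params [] Q \<in> constructible" using IH[of "[]"] Cons a by simp
        then show ?thesis by (simp only: eq)
      next
        case (Suc d)
        have P: "poly_family (Suc d) P1" using fams Cons a Suc by auto
        have "solvable_params dps Q = {e. \<exists>x. poly (P1 e) x = 0 \<and> poly (Q e) x \<noteq> 0}"
          unfolding solvable_params_def Cons Nil a by simp
        then have "{e. coeff (P1 e) d \<noteq> 0} \<inter> solvable_params dps Q \<in> constructible"
          using constructible_single_equation[OF P assms(2)] by simp
        then show ?thesis using split[of dps d P1 "[]"] Cons Nil a Suc fams by auto
      qed
    next
      case (Cons b M)
      obtain d2 P2 where b: "b = (d2, P2)" by force
      \<comment> \<open>With two equations, the formally shorter one shortens the other.\<close>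
      have two: "solvable_params L Q \<in> constructible"
        if L: "L = (d, P) # (k, R) # M" "d \<le> k" "poly_family d P" "poly_family k R"
          "(\<Sum>(d, P) \<leftarrow> L. Suc d) = (\<Sum>(d, P) \<leftarrow> dps. Suc d)" for L d k P R
      proof (cases d)
        case 0
        then have "P = (\<lambda>e. 0)" using L poly_family_0 by auto
        then have "solvable_params L Q = solvable_params ((k, R) # M) Q" using L by (auto simp: solvable_params_def)
        moreover have "solvable_params ((k, R) # M) Q \<in> constructible"
          using L fams \<open>dps = a # dps'\<close> Cons by (intro IH) auto
        ultimately show ?thesis by simp
      next
        case (Suc d')
        then obtain k' where k': "k = Suc k'" "d' \<le> k'" using L by (cases k) auto
        let ?R = "\<lambda>e. smult (coeff (P e) d') (R e) - monom (coeff (R e) k') (k' - d') * P e"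
        have R': "poly_family k' ?R" using poly_family_cancel[of d' P k' R] L Suc k' by auto
        have "{e. coeff (P e) d' \<noteq> 0} \<inter> solvable_params L Q
          = {e. coeff (P e) d' \<noteq> 0} \<inter> solvable_params ((d, P) # (k', ?R) # M) Q"
          unfolding solvable_params_def L(1) by (auto intro!: exI)
        moreover have "solvable_params ((d, P) # (k', ?R) # M) Q \<in> constructible"
          using L fams \<open>dps = a # dps'\<close> Cons R' k' by (intro IH) auto
        ultimately have "{e. coeff (P e) d' \<noteq> 0} \<inter> solvable_params L Q \<in> constructible"
          using constructible_Int[OF constructible_neq[OF poly_family_coeff[OF L(3)]]] by simp
        moreover have "\<forall>(d, P) \<in> set L. poly_family d P" using L fams \<open>dps = a # dps'\<close> Cons by auto
        ultimately show ?thesis using split[of L d' P "(k, R) # M"] L Suc by auto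
      qed
      have fam12: "poly_family d1 P1" "poly_family d2 P2" using fams \<open>dps = a # dps'\<close> Cons a b by auto
      show ?thesis
      proof (cases "d1 \<le> d2")
        case True
        then show ?thesis using two[of dps d1 P1 d2 P2] fam12 \<open>dps = a # dps'\<close> Cons a b by simp
      next
        case False
        have "solvable_params dps Q = solvable_params ((d2, P2) # (d1, P1) # M) Q"
          unfolding solvable_params_def \<open>dps = a # dps'\<close> Cons a b by auto
        then show ?thesis using two[of "(d2, P2) # (d1, P1) # M" d2 P2 d1 P1] fam12 False \<open>dps = a # dps'\<close> Cons a b
          by simp
      qed
    qed
  qed
qed

text \<open>This is Chevalley's theorem on projections of constructible sets, for the elimination of one variable.\<close>

lemma constructible_Ex:
  assumes "T \<in> constructible" shows "{e. \<exists>x. e(v := x) \<in> T} \<in> constructible"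
  using assms
proof induction
  case (cell fs g)
  have ex: "\<exists>dP. poly_family (fst dP) (snd dP) \<and> (\<forall>e x. f (e(v := x)) = poly (snd dP e) x)" if "f \<in> polyfuns" for f
  proof -
    define S where "S w = (\<lambda>e::'a \<Rightarrow> complex. if w = v then monom 1 1 else monom (e w) 0)" for w
    have "\<exists>d. poly_family d (S w)" for w
      unfolding S_def using poly_family_monom[OF polyfun_const[of 1], of 1] poly_family_monom[OF polyfun_var[of w], of 0]
      by (cases "w = v") auto
    moreover have "(\<lambda>w. poly (S w e) x) = e(v := x)" for e x
      unfolding S_def by (auto simp: poly_monom)
    ultimately show ?thesis using polyfun_subst_family[OF that, of S] by auto
  qed
  then obtain h where h: "\<And>f. f \<in> polyfuns \<Longrightarrow> poly_family (fst (h f)) (snd (h f))"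
    "\<And>f e x. f \<in> polyfuns \<Longrightarrow> f (e(v := x)) = poly (snd (h f) e) x" by metis
  obtain L where L: "set L = h ` fs" using cell(1) finite_list by (metis finite_imageI)
  have "{e. \<exists>x. e(v := x) \<in> {e. (\<forall>f\<in>fs. f e = 0) \<and> g e \<noteq> 0}} = solvable_params L (snd (h g))"
    unfolding solvable_params_def L using cell(2,3) by (auto simp: h(2)[OF cell(3)] h(2)[OF subsetD[OF cell(2)]] split_beta)
  also have "\<dots> \<in> constructible" using h(1) cell L
    by (intro constructible_solvable_params[of _ "fst (h g)"]) (auto simp: split_beta)
  finally show ?case .
next
  case (Un S T)
  have "{e. \<exists>x. e(v := x) \<in> S \<union> T} = {e. \<exists>x. e(v := x) \<in> S} \<union> {e. \<exists>x. e(v := x) \<in> T}" by auto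
  then show ?case using constructible.Un[OF Un.IH] by (simp only:)
qed

lemma constructible_Ex_finite:
  assumes "finite V" "T \<in> constructible"
  shows "{e. \<exists>e'\<in>T. \<forall>w. w \<notin> V \<longrightarrow> e' w = e w} \<in> constructible"
  using assms(1)
proof induction
  case empty
  have "{e. \<exists>e'\<in>T. \<forall>w. w \<notin> {} \<longrightarrow> e' w = e w} = T" by (auto simp: fun_eq_iff[symmetric])
  then show ?case using assms(2) by simp
next
  case (insert v V)
  have "{e. \<exists>e'\<in>T. \<forall>w. w \<notin> insert v V \<longrightarrow> e' w = e w}
    = {e. \<exists>x. e(v := x) \<in> {e. \<exists>e'\<in>T. \<forall>w. w \<notin> V \<longrightarrow> e' w = e w}}" (is "?A = ?B")
  proof (intro Set.set_eqI iffI)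
    fix e assume "e \<in> ?A"
    then obtain e' where "e' \<in> T" "\<forall>w. w \<notin> insert v V \<longrightarrow> e' w = e w" by blast
    then show "e \<in> ?B" by (auto intro!: exI[of _ "e' v"] bexI[of _ e'])
  next
    fix e assume "e \<in> ?B"
    then obtain x e' where "e' \<in> T" "\<And>w. w \<notin> V \<Longrightarrow> e' w = (e(v := x)) w" by blast
    then show "e \<in> ?A" by (auto intro!: bexI[of _ e'])
  qed
  then show ?case using constructible_Ex[OF insert.IH] by simp
qed

text \<open>A constructible set is either generically full or generically empty. A cell is empty on a dense open
set unless all of its equations are trivial, in which case it is itself open.\<close>

lemma constructible_generic:
  assumes "T \<in> constructible"
  shows "\<exists>f\<in>polyfuns. (\<exists>e. f e \<noteq> 0) \<and> ({e. f e \<noteq> 0} \<subseteq> T \<or> {e. f e \<noteq> 0} \<inter> T = {})"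
  using assms
proof induction
  case (cell fs g)
  consider f e where "f \<in> fs" "f e \<noteq> 0" | "\<forall>f\<in>fs. \<forall>e. f e = 0" "\<exists>e. g e \<noteq> 0" | "\<forall>e. g e = 0"
    by blast
  then show ?case
  proof cases
    case 1
    then show ?thesis using cell
      by (intro bexI[where x = f] conjI disjI2) auto
  next
    case 2
    then show ?thesis using cell
      by (intro bexI[where x = g] conjI disjI1) auto
  next
    case 3
    then show ?thesis
      by (intro bexI[where x = "\<lambda>e. 1"] conjI disjI2) (auto intro: polyfun_const)
  qed
next
  case (Un S T)
  obtain f where f: "f \<in> polyfuns"
    "(\<exists>e. f e \<noteq> 0) \<and> ({e. f e \<noteq> 0} \<subseteq> S \<or> {e. f e \<noteq> 0} \<inter> S = {})"
    using Un.IH(1) by (rule bexE)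
  obtain g where g: "g \<in> polyfuns"
    "(\<exists>e. g e \<noteq> 0) \<and> ({e. g e \<noteq> 0} \<subseteq> T \<or> {e. g e \<noteq> 0} \<inter> T = {})"
    using Un.IH(2) by (rule bexE)
  obtain a b where "f a \<noteq> 0" "g b \<noteq> 0" using f(2) g(2) by metis
  then have "\<exists>e. f e * g e \<noteq> 0" by (rule polyfun_mult_nonzero[OF f(1) g(1)])
  moreover have eq: "{e. f e * g e \<noteq> 0} = {e. f e \<noteq> 0} \<inter> {e. g e \<noteq> 0}" by auto
  have "A \<inter> B \<subseteq> S \<union> T \<or> (A \<inter> B) \<inter> (S \<union> T) = {}"
    if "A \<subseteq> S \<or> A \<inter> S = {}" "B \<subseteq> T \<or> B \<inter> T = {}" for A B
    using that by blast
  from this[OF conjunct2[OF f(2)] conjunct2[OF g(2)]]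
  have "{e. f e * g e \<noteq> 0} \<subseteq> S \<union> T \<or> {e. f e * g e \<noteq> 0} \<inter> (S \<union> T) = {}"
    unfolding eq .
  ultimately have conj: "(\<exists>e. f e * g e \<noteq> 0) \<and>
      ({e. f e * g e \<noteq> 0} \<subseteq> S \<union> T \<or> {e. f e * g e \<noteq> 0} \<inter> (S \<union> T) = {})" by (rule conjI)
  show ?case
  proof (rule bexI[where x = "\<lambda>e. f e * g e"])
    show "(\<lambda>e. f e * g e) \<in> polyfuns" by (rule polyfun_mult[OF f(1) g(1)])
  qed (rule conj)
qed

section \<open>Polynomial functions vanishing along curves\<close>

text \<open>Expand f at the point a into homogeneous parts. Along a curve g with (g \<epsilon> - a) / \<epsilon>^2 tending
to z, the lowest part that is not identically zero dominates, so its value at z is the limit of a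
function that vanishes. As z is arbitrary, no homogeneous part can be nonzero. The curves run
at speed \<epsilon>^2 so that displacements of second order in the parameters can be used as well.\<close>

lemma polyfun_vanish_on_curves:
  fixes f :: "('v \<Rightarrow> complex) \<Rightarrow> complex"
  assumes f: "f \<in> polyfuns"
    and curve: "\<And>z. \<exists>g. (\<forall>v. ((\<lambda>\<epsilon>. (g \<epsilon> v - a v) / \<epsilon>\<^sup>2) \<longlongrightarrow> z v) (at (0::complex))) \<and>
                    (\<forall>\<^sub>F \<epsilon> in at 0. f (g \<epsilon>) = 0)"
  shows "f e = 0"
proof -
  \<comment> \<open>As a polynomial in \<delta>, the function f at a + \<delta> z has the homogeneous parts as coefficients.\<close>
  define S where "S w = (\<lambda>z::'v \<Rightarrow> complex. [:a w, z w:])" for w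
  have S: "\<exists>d. poly_family d (S w)" for w
  proof -
    have "S w = (\<lambda>e. monom (a w) 0 + monom (e w) 1)" unfolding S_def 
      by (simp add: fun_eq_iff monom_0 monom_Suc)
    then show ?thesis
      using poly_family_add[OF poly_family_monom[OF polyfun_const[of "a w"], of 0] poly_family_monom[OF polyfun_var[of w], of 1]]
      by (auto simp only:)
  qed
  obtain d P where P: "poly_family d P" "\<And>z \<delta>. f (\<lambda>v. a v + \<delta> * z v) = poly (P z) \<delta>"
  proof -
    obtain d P where "poly_family d P" "\<And>z \<delta>. f (\<lambda>v. poly (S v z) \<delta>) = poly (P z) \<delta>"
      using polyfun_subst_family[OF f, of S] S by blast
    then show ?thesis using that unfolding S_def by simp
  qed
  have all0: "coeff (P z) k = 0" for z k
  proof (induction k arbitrary: z rule: less_induct)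
    case (less k)
    obtain g where g: "\<And>v. ((\<lambda>\<epsilon>. (g \<epsilon> v - a v) / \<epsilon>\<^sup>2) \<longlongrightarrow> z v) (at (0::complex))"
       "\<forall>\<^sub>F \<epsilon> in at 0. f (g \<epsilon>) = 0" using curve[of z] by blast
    define Z where "Z \<epsilon> v = (g \<epsilon> v - a v) / \<epsilon>\<^sup>2" for \<epsilon> v
    \<comment> \<open>The value of f along the curve, divided by the k-th power of \<epsilon>^2; the parts below k vanish by
      induction.\<close>
    define h where "h \<epsilon> = (\<Sum>i<d. coeff (P (Z \<epsilon>)) (i + k) * (\<epsilon>\<^sup>2) ^ i)" for \<epsilon>
    have Z: "((\<lambda>\<epsilon>. coeff (P (Z \<epsilon>)) i) \<longlongrightarrow> coeff (P z) i) (at 0)" for i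
      using polyfun_tendsto[OF poly_family_coeff[OF P(1)], of Z z] g(1) unfolding Z_def by blast
    have "((\<lambda>\<epsilon>. \<epsilon>\<^sup>2) \<longlongrightarrow> 0) (at (0::complex))" by (auto intro!: tendsto_eq_intros)
    then have "(h \<longlongrightarrow> (\<Sum>i<d. coeff (P z) (i + k) * 0 ^ i)) (at 0)"
      unfolding h_def by (intro tendsto_intros Z)
    moreover have "(\<Sum>i<d. coeff (P z) (i + k) * 0 ^ i) = coeff (P z) k"
    proof (cases "d = 0")
      case True then show ?thesis using P(1) by (simp add: poly_family_def)
    next
      case False
      then have "(\<Sum>i<d. coeff (P z) (i + k) * 0 ^ i) = (\<Sum>i\<in>{0}. coeff (P z) (i + k) * 0 ^ i)"
        by (intro sum.mono_neutral_right) auto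
      then show ?thesis by simp
    qed
    moreover have "\<forall>\<^sub>F \<epsilon> in at 0. h \<epsilon> = 0"
      using g(2) eventually_neq_at_within[of 0 0 UNIV]
    proof eventually_elim
      case (elim \<epsilon>)
      then have \<epsilon>: "\<epsilon> \<noteq> 0" by blast
      have "g \<epsilon> = (\<lambda>v. a v + \<epsilon>\<^sup>2 * Z \<epsilon> v)" using \<epsilon> by (auto simp: Z_def)
      then have "0 = poly (P (Z \<epsilon>)) (\<epsilon>\<^sup>2)" using elim P(2) by metis
      also have "\<dots> = (\<Sum>i\<in>{0 + k..<d + k}. coeff (P (Z \<epsilon>)) i * (\<epsilon>\<^sup>2) ^ i)"
        unfolding poly_altdef using P(1) less
        by (intro sum.mono_neutral_cong) (auto simp: poly_family_def coeff_eq_0 not_less)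
      also have "\<dots> = (\<Sum>i\<in>{0..<d}. coeff (P (Z \<epsilon>)) (i + k) * (\<epsilon>\<^sup>2) ^ (i + k))"
        by (rule sum.shift_bounds_nat_ivl)
      also have "\<dots> = (\<epsilon>\<^sup>2) ^ k * h \<epsilon>"
        unfolding h_def sum_distrib_left by (simp add: power_add atLeast0LessThan algebra_simps)
      finally show ?case using \<epsilon> by auto
    qed
    then have "(h \<longlongrightarrow> 0) (at 0)" by (rule tendsto_eventually)
    ultimately show ?case using tendsto_unique[OF at_neq_bot] by metis
  qed
  have "f e = poly (P (\<lambda>v. e v - a v)) 1" using P(2)[of 1 "\<lambda>v. e v - a v"] by simp
  also have "P (\<lambda>v. e v - a v) = 0" using all0 by (auto simp: poly_eq_iff)
  finally show ?thesis by simp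
qed

section \<open>Equivalence of matrices\<close>

lemma mult_mat_entry:
  assumes "A \<in> carrier_mat n n" "B \<in> carrier_mat n n" "i < n" "j < n"
  shows "(A * B) $$ (i, j) = (\<Sum>r<n. A $$ (i, r) * B $$ (r, j))"
  using assms by (auto simp: scalar_prod_def atLeast0LessThan)

lemma det_nonzero_inverse:
  fixes X :: "complex mat"
  assumes X: "X \<in> carrier_mat n n" and det: "det X \<noteq> 0"
  shows "X * ((1 / det X) \<cdot>\<^sub>m adj_mat X) = 1\<^sub>m n" "((1 / det X) \<cdot>\<^sub>m adj_mat X) * X = 1\<^sub>m n"
proof -
  note adj = adj_mat[OF X]
  show "X * ((1 / det X) \<cdot>\<^sub>m adj_mat X) = 1\<^sub>m n"
    using det by (subst mult_smult_distrib[OF X adj(1)]) (auto simp: adj(2))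
  show "((1 / det X) \<cdot>\<^sub>m adj_mat X) * X = 1\<^sub>m n"
    using det by (subst mult_smult_assoc_mat[OF adj(1) X]) (auto simp: adj(3))
qed

lemma invertible_mat_iff_det:
  fixes X :: "complex mat"
  assumes X: "X \<in> carrier_mat n n"
  shows "invertible_mat X \<longleftrightarrow> det X \<noteq> 0"
proof
  assume "invertible_mat X"
  then obtain Y where Y: "X * Y = 1\<^sub>m n" "Y * X = 1\<^sub>m (dim_row Y)"
    using X unfolding invertible_mat_def inverts_mat_def by auto
  have "dim_col (X * Y) = n" "dim_col (Y * X) = dim_row Y" unfolding Y by simp_all
  then have "dim_col Y = n" "dim_row Y = n" using carrier_matD[OF X] by simp_all
  then have Yc: "Y \<in> carrier_mat n n" by (intro carrier_matI)
  have "det X * det Y = 1" unfolding det_mult[OF X Yc, symmetric] Y(1) by (rule det_one)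
  then show "det X \<noteq> 0" by auto
next
  assume det: "det X \<noteq> 0"
  show "invertible_mat X"
    unfolding invertible_mat_def inverts_mat_def
    using det_nonzero_inverse[OF X det] X adj_mat(1)[OF X]
    by (intro conjI exI[of _ "(1 / det X) \<cdot>\<^sub>m adj_mat X"]) auto
qed

definition equiv_mat :: "nat \<Rightarrow> complex mat \<Rightarrow> complex mat \<Rightarrow> bool" where
  "equiv_mat n M N \<longleftrightarrow> (\<exists>P Q. P \<in> carrier_mat n n \<and> Q \<in> carrier_mat n n \<and>
     det P \<noteq> 0 \<and> det Q \<noteq> 0 \<and> M = P * N * Q)"

lemma equiv_matI:
  assumes "P \<in> carrier_mat n n" "Q \<in> carrier_mat n n" "det P \<noteq> 0" "det Q \<noteq> 0" "M = P * N * Q"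
  shows "equiv_mat n M N"
  using assms unfolding equiv_mat_def by blast

lemma equiv_mat_trans:
  assumes "equiv_mat n M N" "equiv_mat n N K" "K \<in> carrier_mat n n"
  shows "equiv_mat n M K"
proof -
  obtain P Q where PQ: "P \<in> carrier_mat n n" "Q \<in> carrier_mat n n" "det P \<noteq> 0" "det Q \<noteq> 0" "M = P * N * Q"
    using assms(1) unfolding equiv_mat_def by blast
  obtain P' Q' where PQ': "P' \<in> carrier_mat n n" "Q' \<in> carrier_mat n n" "det P' \<noteq> 0" "det Q' \<noteq> 0" "N = P' * K * Q'"
    using assms(2) unfolding equiv_mat_def by blast
  have "M = (P * P') * K * (Q' * Q)"
    unfolding PQ(5) PQ'(5) using PQ(1,2) PQ'(1,2) assms(3)
    by (smt (verit) assoc_mult_mat mult_carrier_mat)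
  then show ?thesis unfolding equiv_mat_def using PQ PQ'
    by (intro exI[of _ "P * P'"] exI[of _ "Q' * Q"]) (auto simp: det_mult)
qed

lemma equiv_mat_swap:
  assumes N: "N \<in> carrier_mat n n" and ab: "a < n" "b < n" "c < n" "d < n"
  shows "equiv_mat n N (mat n n (\<lambda>(i, j). N $$ (transpose a c i, transpose b d j)))"
proof -
  have sw: "swaprows_mat n k l \<in> carrier_mat n n" "det (swaprows_mat n k l :: complex mat) \<noteq> 0"
    if "k < n" "l < n" for k l
  proof (goal_cases)
    case 1 show ?case by simp
  next
    case 2
    have "swaprows_mat n k k = (1\<^sub>m n :: complex mat)" by (rule eq_matI) auto
    then show ?case using det_swaprows_mat[OF that, where 'a = complex] by (cases "k = l") auto
  qed
  let ?N = "mat n n (\<lambda>(i, j). N $$ (transpose a c i, transpose b d j))"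
  have "N = swapcols b d (swaprows a c ?N)"
    using N ab by (intro eq_matI) (auto simp: transpose_def)
  also have "\<dots> = swaprows_mat n a c * ?N * swaprows_mat n b d"
  proof -
    have "?N \<in> carrier_mat n n" by simp
    from swaprows_mat[OF this ab(1,3)] have eq: "swaprows a c ?N = swaprows_mat n a c * ?N" .
    have "swaprows a c ?N \<in> carrier_mat n n" unfolding eq
      by (rule mult_carrier_mat[OF sw(1)[OF ab(1,3)]]) simp
    from swapcols_mat[OF this ab(2,4)] show ?thesis unfolding eq .
  qed
  finally have "N = swaprows_mat n a c * ?N * swaprows_mat n b d" .
  then show ?thesis by (rule equiv_matI[OF sw(1)[OF ab(1,3)] sw(1)[OF ab(2,4)] sw(2)[OF ab(1,3)] sw(2)[OF ab(2,4)]])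
qed

text \<open>Gaussian elimination with pivot (k, k), clearing its column by L and its row by R at the same time.
Since the entries before the pivot are already zero, L and R are triangular with unit diagonal.\<close>

lemma equiv_mat_clear_cross:
  assumes N: "N \<in> carrier_mat n n" and k: "k < n" and p: "N $$ (k, k) \<noteq> 0"
    and clean: "\<And>i. i < k \<Longrightarrow> N $$ (i, k) = 0" "\<And>j. j < k \<Longrightarrow> N $$ (k, j) = 0"
  shows "equiv_mat n N (mat n n (\<lambda>(i, j).
    if i = k \<and> j = k then N $$ (k, k) else if i = k \<or> j = k then 0
    else N $$ (i, j) - N $$ (i, k) * N $$ (k, j) / N $$ (k, k)))" (is "equiv_mat n N ?K")
proof -
  define L where "L = mat n n (\<lambda>(i, j). (if i = j then 1 else 0) + (if j = k then
     if i = k then 0 else N $$ (i, k) / N $$ (k, k) else 0))"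
  define R where "R = mat n n (\<lambda>(i, j). (if i = j then 1 else 0) + (if i = k then
     if j = k then 0 else N $$ (k, j) / N $$ (k, k) else 0))"
  have L: "L \<in> carrier_mat n n" and R: "R \<in> carrier_mat n n"
    unfolding L_def R_def by auto
  have "det L = prod_list (diag_mat L)"
    by (rule det_lower_triangular[OF _ L]) (auto simp: L_def clean)
  moreover have "L $$ (i, i) = 1" if "i < n" for i using that by (cases "i = k") (simp_all add: L_def)
  ultimately have detL: "det L \<noteq> 0" using L by (auto simp: prod_list_zero_iff diag_mat_def)
  have "det R = prod_list (diag_mat R)"
    by (rule det_upper_triangular[OF _ R]) (auto simp: R_def clean)
  moreover have "R $$ (i, i) = 1" if "i < n" for i using that by (cases "i = k") (simp_all add: R_def)
  ultimately have detR: "det R \<noteq> 0" using R by (auto simp: prod_list_zero_iff diag_mat_def)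
  define K where "K = ?K"
  have KC: "K \<in> carrier_mat n n" by (simp add: K_def)
  have LKC: "L * K \<in> carrier_mat n n" by (rule mult_carrier_mat[OF L KC])
  have LK: "(L * K) $$ (i, j) = K $$ (i, j) + (if i = k then 0 else N $$ (i, k) / N $$ (k, k)) * K $$ (k, j)"
    if "i < n" "j < n" for i j
  proof -
    have "(L * K) $$ (i, j) = (\<Sum>r<n. L $$ (i, r) * K $$ (r, j))" by (rule mult_mat_entry[OF L KC that])
    also have "\<dots> = (\<Sum>r<n. (if i = r then K $$ (r, j) else 0) +
        (if r = k then (if i = k then 0 else N $$ (i, k) / N $$ (k, k)) * K $$ (r, j) else 0))"
      by (intro sum.cong refl) (use that in \<open>auto simp: L_def algebra_simps\<close>)
    finally show ?thesis using that k by (simp add: sum.distrib)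
  qed
  have "N = L * K * R"
  proof (rule eq_matI)
    fix i j assume "i < dim_row (L * K * R)" "j < dim_col (L * K * R)"
    then have ij: "i < n" "j < n" using L R by auto
    have "(L * K * R) $$ (i, j) = (\<Sum>r<n. (L * K) $$ (i, r) * R $$ (r, j))"
      by (rule mult_mat_entry[OF LKC R ij])
    also have "\<dots> = (\<Sum>r<n. (if r = j then (L * K) $$ (i, r) else 0) +
        (if r = k then (if j = k then 0 else N $$ (k, j) / N $$ (k, k)) * (L * K) $$ (i, r) else 0))"
      by (intro sum.cong refl) (use ij in \<open>auto simp: R_def algebra_simps simp del: index_mult_mat(1)\<close>)
    also have "\<dots> = (L * K) $$ (i, j) + (if j = k then 0 else N $$ (k, j) / N $$ (k, k)) * (L * K) $$ (i, k)"
      using ij k by (simp add: sum.distrib del: index_mult_mat(1))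
    also have "\<dots> = N $$ (i, j)"
      unfolding LK[OF ij] LK[OF ij(1) k] using ij k p by (auto simp: K_def)
    finally show "N $$ (i, j) = (L * K * R) $$ (i, j)" by simp
  qed (use N L R in auto)
  then show ?thesis unfolding K_def by (rule equiv_matI[OF L R detL detR])
qed

text \<open>Elimination on rows and columns alternately: after k steps the first k rows and columns have
no entries off the diagonal. If the remaining block is nonzero, a nonzero entry of it is swapped to
position (k, k) and its cross is cleared; otherwise nothing is left to do.\<close>

lemma equiv_mat_diagonal:
  assumes M: "M \<in> carrier_mat n n"
  shows "\<exists>E. E \<in> carrier_mat n n \<and> diagonal_mat E \<and> equiv_mat n M E"
proof -
  have "\<exists>N. N \<in> carrier_mat n n \<and> equiv_mat n M N \<and>
     (\<forall>i<n. \<forall>j<n. i \<noteq> j \<longrightarrow> i < k \<or> j < k \<longrightarrow> N $$ (i, j) = 0)" if "k \<le> n" for k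
    using that
  proof (induction k)
    case 0
    have "equiv_mat n M M" unfolding equiv_mat_def
      by (intro exI[of _ "1\<^sub>m n"]) (use M in auto)
    then show ?case using M by auto
  next
    case (Suc k)
    then obtain N where N: "N \<in> carrier_mat n n" "equiv_mat n M N"
      "\<And>i j. i < n \<Longrightarrow> j < n \<Longrightarrow> i \<noteq> j \<Longrightarrow> i < k \<or> j < k \<Longrightarrow> N $$ (i, j) = 0" by auto
    show ?case
    proof (cases "\<forall>i<n. \<forall>j<n. k \<le> i \<longrightarrow> k \<le> j \<longrightarrow> N $$ (i, j) = 0")
      case True
      then have "\<forall>i<n. \<forall>j<n. i \<noteq> j \<longrightarrow> i < Suc k \<or> j < Suc k \<longrightarrow> N $$ (i, j) = 0"
        using N(3) by (meson not_le)
      then show ?thesis using N by blast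
    next
      case False
      then obtain a b where ab: "a < n" "b < n" "k \<le> a" "k \<le> b" "N $$ (a, b) \<noteq> 0" by blast
      define N1 where "N1 = mat n n (\<lambda>(i, j). N $$ (transpose a k i, transpose b k j))"
      have k: "k < n" using Suc by simp
      have N1: "N1 \<in> carrier_mat n n" "equiv_mat n M N1" "N1 $$ (k, k) \<noteq> 0"
        using equiv_mat_trans[OF N(2) equiv_mat_swap[OF N(1) ab(1,2) k k]] ab k
        by (auto simp: N1_def)
      have clean: "N1 $$ (i, j) = 0" if "i < n" "j < n" "i \<noteq> j" "i < k \<or> j < k" for i j
      proof -
        have "transpose a k i < n" "transpose b k j < n" using that ab k by (auto simp: transpose_def)
        moreover have "transpose a k i \<noteq> transpose b k j" "transpose a k i < k \<or> transpose b k j < k"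
          using that ab by (auto simp: transpose_def)
        ultimately show ?thesis using N(3) that by (simp add: N1_def)
      qed
      let ?K = "mat n n (\<lambda>(i, j).
        if i = k \<and> j = k then N1 $$ (k, k) else if i = k \<or> j = k then 0
        else N1 $$ (i, j) - N1 $$ (i, k) * N1 $$ (k, j) / N1 $$ (k, k))"
      have "equiv_mat n M ?K"
        by (rule equiv_mat_trans[OF N1(2) equiv_mat_clear_cross[OF N1(1) k N1(3)]])
          (use k clean in auto)
      moreover have "\<forall>i<n. \<forall>j<n. i \<noteq> j \<longrightarrow> i < Suc k \<or> j < Suc k \<longrightarrow> ?K $$ (i, j) = 0"
        using clean k by (auto simp: less_Suc_eq)
      ultimately show ?thesis by (intro exI[of _ ?K]) simp
    qed
  qed
  from this[of n] show ?thesis by (auto simp: diagonal_mat_def)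
qed

section \<open>Products of two generic matrices\<close>

text \<open>Entries outside the matrix are unspecified in the matrix type, so the assignment is set to zero there.\<close>

definition entries :: "nat \<Rightarrow> complex mat \<Rightarrow> nat \<times> nat \<Rightarrow> complex" where
  "entries n X = (\<lambda>(p, q). if p < n \<and> q < n then X $$ (p, q) else 0)"

text \<open>A polynomial function of quotients with a common denominator becomes polynomial after multiplication
by a power of this denominator. It is applied to the inverse matrix, with the determinant as
denominator.\<close>

lemma polyfun_clear_denominator:
  assumes "f \<in> polyfuns" "\<And>v. N v \<in> polyfuns" "\<delta> \<in> polyfuns"
  shows "\<exists>k. \<exists>H\<in>polyfuns. \<forall>e. \<delta> e \<noteq> 0 \<longrightarrow> f (\<lambda>v. N v e / \<delta> e) * \<delta> e ^ k = H e"
  using assms(1)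
proof induction
  case (polyfun_const c)
  show ?case by (rule exI[of _ 0], rule bexI[where x = "\<lambda>e. c"]) (auto intro: polyfuns.polyfun_const)
next
  case (polyfun_var v)
  show ?case by (rule exI[of _ 1], rule bexI[where x = "N v"]) (auto intro: assms)
next
  case (polyfun_add f g)
  obtain k H where f: "H \<in> polyfuns" "\<And>e. \<delta> e \<noteq> 0 \<Longrightarrow> f (\<lambda>v. N v e / \<delta> e) * \<delta> e ^ k = H e"
    using polyfun_add.IH(1) by blast
  obtain l G where g: "G \<in> polyfuns" "\<And>e. \<delta> e \<noteq> 0 \<Longrightarrow> g (\<lambda>v. N v e / \<delta> e) * \<delta> e ^ l = G e"
    using polyfun_add.IH(2) by blast
  show ?case
  proof (rule exI[of _ "k + l"], rule bexI[where x = "\<lambda>e. H e * \<delta> e ^ l + G e * \<delta> e ^ k"], intro allI impI)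
    fix e assume "\<delta> e \<noteq> 0"
    then show "(f (\<lambda>v. N v e / \<delta> e) + g (\<lambda>v. N v e / \<delta> e)) * \<delta> e ^ (k + l) = H e * \<delta> e ^ l + G e * \<delta> e ^ k"
      unfolding f(2)[symmetric, OF \<open>\<delta> e \<noteq> 0\<close>] g(2)[symmetric, OF \<open>\<delta> e \<noteq> 0\<close>]
      by (simp add: power_add algebra_simps)
  qed (intro polyfuns.polyfun_add polyfuns.polyfun_mult polyfun_power f g assms)
next
  case (polyfun_mult f g)
  obtain k H where f: "H \<in> polyfuns" "\<And>e. \<delta> e \<noteq> 0 \<Longrightarrow> f (\<lambda>v. N v e / \<delta> e) * \<delta> e ^ k = H e"
    using polyfun_mult.IH(1) by blast
  obtain l G where g: "G \<in> polyfuns" "\<And>e. \<delta> e \<noteq> 0 \<Longrightarrow> g (\<lambda>v. N v e / \<delta> e) * \<delta> e ^ l = G e"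
    using polyfun_mult.IH(2) by blast
  show ?case
  proof (rule exI[of _ "k + l"], rule bexI[where x = "\<lambda>e. H e * G e"], intro allI impI)
    fix e assume "\<delta> e \<noteq> 0"
    then show "f (\<lambda>v. N v e / \<delta> e) * g (\<lambda>v. N v e / \<delta> e) * \<delta> e ^ (k + l) = H e * G e"
      unfolding f(2)[symmetric, OF \<open>\<delta> e \<noteq> 0\<close>] g(2)[symmetric, OF \<open>\<delta> e \<noteq> 0\<close>]
      by (simp add: power_add algebra_simps)
  qed (intro polyfuns.polyfun_mult f g)
qed

lemma polyfun_mat_mult:
  assumes "\<And>e. A e \<in> carrier_mat n n" "\<And>e. B e \<in> carrier_mat n n"
    and "\<And>i j. i < n \<Longrightarrow> j < n \<Longrightarrow> (\<lambda>e. A e $$ (i, j)) \<in> polyfuns"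
    and "\<And>i j. i < n \<Longrightarrow> j < n \<Longrightarrow> (\<lambda>e. B e $$ (i, j)) \<in> polyfuns"
    and ij: "i < n" "j < n"
  shows "(\<lambda>e. (A e * B e) $$ (i, j)) \<in> polyfuns"
proof -
  have "(A e * B e) $$ (i, j) = (\<Sum>k\<in>{0..<n}. A e $$ (i, k) * B e $$ (k, j))" for e
    using assms(1,2)[of e] ij by (auto simp: scalar_prod_def)
  then show ?thesis using assms by (auto intro!: polyfun_sum polyfun_mult)
qed

lemma polyfun_adj_mat:
  assumes A: "\<And>e. A e \<in> carrier_mat n n"
    and polyfuns: "\<And>i j. i < n \<Longrightarrow> j < n \<Longrightarrow> (\<lambda>e. A e $$ (i, j)) \<in> polyfuns"
    and ij: "i < n" "j < n"
  shows "(\<lambda>e. adj_mat (A e) $$ (i, j)) \<in> polyfuns"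
proof -
  have "adj_mat (A e) $$ (i, j) = (-1) ^ (j + i) * det (mat_delete (A e) j i)" for e
    using A[of e] ij by (auto simp: adj_mat_def cofactor_def)
  moreover have "(\<lambda>e. det (mat_delete (A e) j i)) \<in> polyfuns"
  proof (rule polyfun_det[where n = "n - 1"])
    fix k l assume kl: "k < n - 1" "l < n - 1"
    have "mat_delete (A e) j i $$ (k, l) = A e $$ (if k < j then k else Suc k, if l < i then l else Suc l)" for e
      using A[of e] kl unfolding mat_delete_def by auto
    then show "(\<lambda>e. mat_delete (A e) j i $$ (k, l)) \<in> polyfuns" using kl polyfuns by auto
  qed (use mat_delete_carrier[OF A] in auto)
  ultimately show ?thesis by (auto intro: polyfun_mult polyfun_const)
qed

text \<open>It suffices to find X with f(X), det X and f(X\<inverse> M) all nonzero. Up to a power of det X, each of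
these is a polynomial function of the entries of X, so by the absence of zero divisors each may be
made nonzero separately. The last one is nonzero at X = M Y\<inverse> for an invertible Y with f(Y) nonzero.\<close>

lemma invertible_product_of_generic:
  assumes f: "f \<in> polyfuns" and X0: "f (entries n X0) \<noteq> 0" and M: "M \<in> carrier_mat n n" "det M \<noteq> 0"
  shows "\<exists>X Y. X \<in> carrier_mat n n \<and> Y \<in> carrier_mat n n \<and> M = X * Y \<and>
    f (entries n X) \<noteq> 0 \<and> f (entries n Y) \<noteq> 0"
proof -
  define m where "m e = mat n n e" for e :: "nat \<times> nat \<Rightarrow> complex"
  define g where "g e = f (entries n (m e))" for e
  define \<delta> where "\<delta> e = det (m e)" for e
  define Nm where "Nm e = adj_mat (m e) * M" for e
  have m: "m e \<in> carrier_mat n n" for e by (simp add: m_def)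
  have mPF: "(\<lambda>e. m e $$ (i, j)) \<in> polyfuns" if "i < n" "j < n" for i j
    unfolding m_def using that polyfun_var[of "(i, j)"] by simp
  have adj: "adj_mat (m e) \<in> carrier_mat n n" for e using adj_mat(1)[OF m] .
  have NmPF: "(\<lambda>e. entries n (Nm e) v) \<in> polyfuns" for v
    using polyfun_mat_mult[of "\<lambda>e. adj_mat (m e)" n "\<lambda>e. M" "fst v" "snd v", OF adj M(1) polyfun_adj_mat[OF m mPF] polyfun_const]
    by (cases "fst v < n \<and> snd v < n")
      (auto simp: entries_def Nm_def polyfun_const case_prod_unfold simp del: index_mult_mat(1))
  have gPF: "g \<in> polyfuns" unfolding g_def
  proof (rule polyfun_subst[OF f])
    show "(\<lambda>e. entries n (m e) v) \<in> polyfuns" for v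
      using mPF[of "fst v" "snd v"]
      by (cases "fst v < n \<and> snd v < n") (auto simp: entries_def polyfun_const case_prod_unfold)
  qed
  have \<delta>polyfuns: "\<delta> \<in> polyfuns" unfolding \<delta>_def by (rule polyfun_det[OF m mPF])
  have "\<exists>k. \<exists>H\<in>polyfuns. \<forall>e. \<delta> e \<noteq> 0 \<longrightarrow> f (\<lambda>v. entries n (Nm e) v / \<delta> e) * \<delta> e ^ k = H e"
    by (rule polyfun_clear_denominator[OF f NmPF \<delta>polyfuns])
  then obtain k H where H: "H \<in> polyfuns"
    "\<And>e. \<delta> e \<noteq> 0 \<Longrightarrow> f (\<lambda>v. entries n (Nm e) v / \<delta> e) * \<delta> e ^ k = H e"
    by blast
  have quot: "(\<lambda>v. entries n (Nm e) v / \<delta> e) = entries n (((1 / det (m e)) \<cdot>\<^sub>m adj_mat (m e)) * M)" for e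
    using M(1) adj[of e] by (subst mult_smult_assoc_mat[OF adj M(1)])
      (auto simp: fun_eq_iff entries_def Nm_def \<delta>_def simp del: index_mult_mat(1))
  have inv_m: "mat n n (entries n X) = X" if "X \<in> carrier_mat n n" for X
    using that by (intro eq_matI) (auto simp: entries_def)
  have "g (entries n X0) \<noteq> 0"
  proof -
    have "entries n (m (entries n X0)) = entries n X0" by (auto simp: m_def entries_def fun_eq_iff)
    then show ?thesis using X0 by (simp add: g_def)
  qed
  moreover have "\<delta> (entries n (1\<^sub>m n)) \<noteq> 0" unfolding \<delta>_def m_def by (simp add: inv_m)
  ultimately obtain e1 where "g e1 * \<delta> e1 \<noteq> 0" using polyfun_mult_nonzero[OF gPF \<delta>polyfuns] by blast
  then have e1: "g e1 \<noteq> 0" "\<delta> e1 \<noteq> 0" by auto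
  \<comment> \<open>H is nonzero at the entries of X = M Y\<inverse>, where f(X\<inverse> M) = f(Y).\<close>
  define Y where "Y = m e1"
  define X where "X = M * ((1 / det Y) \<cdot>\<^sub>m adj_mat Y)"
  have Y: "Y \<in> carrier_mat n n" "det Y \<noteq> 0" using e1 by (auto simp: Y_def \<delta>_def m)
  have iY: "(1 / det Y) \<cdot>\<^sub>m adj_mat Y \<in> carrier_mat n n" using adj_mat(1)[OF Y(1)] by simp
  have X: "X \<in> carrier_mat n n" unfolding X_def using M iY by simp
  have XY: "X * Y = M"
    unfolding X_def using assoc_mult_mat[OF M(1) iY Y(1)] det_nonzero_inverse(2)[OF Y] M(1) by simp
  have "det X * det Y = det M" unfolding det_mult[OF X Y(1), symmetric] XY by (rule refl)
  then have dX: "det X \<noteq> 0" using M(2) by auto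
  have iX: "(1 / det X) \<cdot>\<^sub>m adj_mat X \<in> carrier_mat n n" using adj_mat(1)[OF X] by simp
  have inv: "((1 / det X) \<cdot>\<^sub>m adj_mat X) * M = Y"
    unfolding XY[symmetric] assoc_mult_mat[OF iX X Y(1), symmetric] det_nonzero_inverse(2)[OF X dX]
    by (rule left_mult_one_mat[OF Y(1)])
  have "H (entries n X) \<noteq> 0"
  proof -
    have mX: "m (entries n X) = X" unfolding m_def by (rule inv_m[OF X])
    have "\<delta> (entries n X) \<noteq> 0" unfolding \<delta>_def mX by (rule dX)
    from H(2)[OF this] have "f (entries n Y) * \<delta> (entries n X) ^ k = H (entries n X)"
      unfolding quot mX inv .
    moreover have "f (entries n Y) \<noteq> 0" using e1(1) by (simp add: g_def Y_def)
    ultimately show ?thesis using \<open>\<delta> (entries n X) \<noteq> 0\<close> by auto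
  qed
  moreover have "g e1 * \<delta> e1 \<noteq> 0" using e1 by simp
  ultimately obtain e2 where "g e2 * \<delta> e2 * H e2 \<noteq> 0"
    using polyfun_mult_nonzero[OF polyfun_mult[OF gPF \<delta>polyfuns] H(1)] by blast
  then have e2: "g e2 \<noteq> 0" "\<delta> e2 \<noteq> 0" "H e2 \<noteq> 0" by auto
  let ?I = "(1 / det (m e2)) \<cdot>\<^sub>m adj_mat (m e2)"
  have I: "?I \<in> carrier_mat n n" using adj by simp
  have "det (m e2) \<noteq> 0" using e2(2) by (simp add: \<delta>_def)
  then have "m e2 * (?I * M) = M"
    unfolding assoc_mult_mat[OF m I M(1), symmetric]
    by (subst det_nonzero_inverse(1)[OF m]) (auto simp: left_mult_one_mat[OF M(1)])
  moreover have "f (entries n (?I * M)) \<noteq> 0"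
    using H(2)[OF e2(2)] e2(3) unfolding quot by auto
  moreover have "f (entries n (m e2)) \<noteq> 0" using e2(1) by (simp add: g_def)
  ultimately show ?thesis using m mult_carrier_mat[OF I M(1)] by metis
qed

section \<open>The set of products of Vandermonde matrices\<close>

definition vand_prod :: "nat \<Rightarrow> (nat \<Rightarrow> int) \<Rightarrow> (nat \<Rightarrow> nat \<Rightarrow> complex) \<Rightarrow> (nat \<Rightarrow> nat \<Rightarrow> complex) \<Rightarrow> complex mat"
  where "vand_prod n s y x = alt_prod n (\<lambda>i. transpose_mat (gen_vandermonde n (s i) (y i)))
     (\<lambda>i. gen_vandermonde n (s i) (x i))"

text \<open>The nodes are required to be nonzero for all types alike; this makes the entries Laurent polynomials
in the nodes without any distinction of cases.\<close>

definition vand_image :: "nat \<Rightarrow> (nat \<Rightarrow> int) \<Rightarrow> complex mat set" where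
  "vand_image n s = {vand_prod n s y x | y x. \<forall>i<n. \<forall>p<n. y i p \<noteq> 0 \<and> x i p \<noteq> 0}"

lemma vand_imageD:
  assumes "X \<in> vand_image n s"
  shows "\<exists>A B. (\<forall>i<n. A i \<in> Vand n (s i) \<and> B i \<in> VandT n (s i)) \<and> X = alt_prod n B A"
proof -
  obtain y x where X: "X = vand_prod n s y x" and nz: "\<forall>i<n. \<forall>p<n. y i p \<noteq> 0 \<and> x i p \<noteq> 0"
    using assms unfolding vand_image_def by blast
  have V: "gen_vandermonde n (s i) z \<in> Vand n (s i)" if "\<forall>p<n. z p \<noteq> 0" for i z
    unfolding Vand_def by (rule CollectI, rule exI[of _ z]) (use that in simp)
  show ?thesis
    unfolding X vand_prod_def VandT_def
    by (rule exI[of _ "\<lambda>i. gen_vandermonde n (s i) (x i)"],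
        rule exI[of _ "\<lambda>i. transpose_mat (gen_vandermonde n (s i) (y i))"])
      (use nz in \<open>simp add: V\<close>)
qed

lemma gen_vandermonde_carrier: "gen_vandermonde n s x \<in> carrier_mat n n"
  by (simp add: gen_vandermonde_def)

lemma foldr_mult_carrier:
  assumes "\<And>i. G i \<in> carrier_mat n n"
  shows "foldr (*) (map G js) (1\<^sub>m n) \<in> carrier_mat n n"
  by (induction js) (auto intro: mult_carrier_mat[OF assms])

lemma alt_prod_carrier:
  assumes "\<And>i. B i \<in> carrier_mat n n" "\<And>i. A i \<in> carrier_mat n n"
  shows "alt_prod n B A \<in> carrier_mat n n"
  unfolding alt_prod_def by (rule foldr_mult_carrier[OF mult_carrier_mat[OF assms]])

lemma vand_prod_carrier: "vand_prod n s y x \<in> carrier_mat n n"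
  unfolding vand_prod_def
  by (intro alt_prod_carrier) (simp_all add: gen_vandermonde_carrier)

lemma polyfun_foldr_mult:
  assumes G: "\<And>e i. G e i \<in> carrier_mat n n"
    and polyfuns: "\<And>i p q. p < n \<Longrightarrow> q < n \<Longrightarrow> (\<lambda>e. G e i $$ (p, q)) \<in> polyfuns"
    and pq: "p < n" "q < n"
  shows "(\<lambda>e. foldr (*) (map (G e) js) (1\<^sub>m n) $$ (p, q)) \<in> polyfuns"
  using pq
proof (induction js arbitrary: p q)
  case Nil show ?case by (simp add: polyfun_const)
next
  case (Cons i js)
  show ?case unfolding list.map foldr_Cons o_apply
    by (rule polyfun_mat_mult[OF G foldr_mult_carrier[OF G] polyfuns Cons.IH Cons.prems])
qed

text \<open>An integer power of a as a polynomial in a and an independent variable b that stands for the inverse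
of a.\<close>

definition laurent_power :: "complex \<Rightarrow> complex \<Rightarrow> int \<Rightarrow> complex" where
  "laurent_power a b j = (if 0 \<le> j then a ^ nat j else b ^ nat (- j))"

lemma laurent_power_inverse: "a * b = 1 \<Longrightarrow> laurent_power a b j = a powi j"
  by (auto simp: laurent_power_def power_int_def dest: inverse_unique)

lemma polyfun_laurent_power: "(\<lambda>e. laurent_power (e u) (e v) j) \<in> polyfuns"
  unfolding laurent_power_def by (cases "0 \<le> j") (auto intro: polyfun_power polyfun_var)

text \<open>The variable (0, p, q) stands for entry (p, q) of the matrix, (1, i, p) and (3, i, p) for the nodes of
B_i and A_i, and (2, i, p) and (4, i, p) for the inverses of these nodes. With the inverses as
variables, the graph of the product map is given by polynomial equations, and the image is obtained
by eliminating all variables other than the entries.\<close>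

lemma constructible_vand_image:
  "{e. mat n n (\<lambda>(p, q). e (0, p, q)) \<in> vand_image n s} \<in> (constructible :: (nat \<times> nat \<times> nat \<Rightarrow> complex) set set)"
proof -
  define L where "L k e i = mat n n (\<lambda>(p, q). laurent_power (e (k, i, q)) (e (Suc k, i, q)) (s i + int p))"
    for k :: nat and e :: "nat \<times> nat \<times> nat \<Rightarrow> complex" and i
  define G where "G e i = transpose_mat (L 1 e i) * L 3 e i" for e i
  define \<Phi> where "\<Phi> e = foldr (*) (map (G e) [0..<n]) (1\<^sub>m n)" for e
  define T where "T = {e. \<forall>i\<in>{..<n}. \<forall>p\<in>{..<n}. e (1, i, p) * e (2, i, p) - 1 = 0 \<and> e (3, i, p) * e (4, i, p) - 1 = 0}
     \<inter> {e. \<forall>p\<in>{..<n}. \<forall>q\<in>{..<n}. e (0, p, q) - \<Phi> e $$ (p, q) = 0}"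
  define V where "V = {1, 2, 3, 4 :: nat} \<times> {..<n} \<times> {..<n}"
  have L: "L k e i \<in> carrier_mat n n" for k e i by (simp add: L_def)
  have G: "G e i \<in> carrier_mat n n" for e i
    unfolding G_def by (rule mult_carrier_mat[OF _ L]) (simp add: L)
  have LPF: "(\<lambda>e. L k e i $$ (p, q)) \<in> polyfuns" if "p < n" "q < n" for k i p q
    using that polyfun_laurent_power by (simp add: L_def)
  have \<Phi>polyfuns: "(\<lambda>e. \<Phi> e $$ (p, q)) \<in> polyfuns" if pq: "p < n" "q < n" for p q
    unfolding \<Phi>_def
  proof (rule polyfun_foldr_mult[OF G _ pq])
    fix i p q assume pq: "p < n" "q < n"
    show "(\<lambda>e. G e i $$ (p, q)) \<in> polyfuns"
      unfolding G_def
    proof (rule polyfun_mat_mult[OF _ L _ LPF pq])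
      fix p q assume "p < n" "q < n"
      then show "(\<lambda>e. transpose_mat (L 1 e i) $$ (p, q)) \<in> polyfuns"
        using LPF[of q p 1 i] carrier_matD[OF L] by simp
    qed (simp_all add: L)
  qed
  have \<Phi>: "\<Phi> e \<in> carrier_mat n n" for e unfolding \<Phi>_def by (rule foldr_mult_carrier[OF G])
  have vp: "\<Phi> e = vand_prod n s (\<lambda>i p. e (1, i, p)) (\<lambda>i p. e (3, i, p))"
    if "\<And>i p. i < n \<Longrightarrow> p < n \<Longrightarrow> e (1, i, p) * e (2, i, p) = 1 \<and> e (3, i, p) * e (4, i, p) = 1" for e
  proof -
    have "L 1 e i = gen_vandermonde n (s i) (\<lambda>p. e (1, i, p))" "L 3 e i = gen_vandermonde n (s i) (\<lambda>p. e (3, i, p))"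
      if "i < n" for i
      using \<open>\<And>i p. i < n \<Longrightarrow> p < n \<Longrightarrow> e (1, i, p) * e (2, i, p) = 1 \<and> e (3, i, p) * e (4, i, p) = 1\<close>[OF that]
      unfolding L_def gen_vandermonde_def
      by (auto intro!: eq_matI laurent_power_inverse simp: numeral_2_eq_2[symmetric])
    then have "map (G e) [0..<n] = map (\<lambda>i. transpose_mat (gen_vandermonde n (s i) (\<lambda>p. e (1, i, p))) *
        gen_vandermonde n (s i) (\<lambda>p. e (3, i, p))) [0..<n]"
      by (intro map_cong refl) (simp add: G_def)
    then show ?thesis unfolding \<Phi>_def vand_prod_def alt_prod_def by (simp only:)
  qed
  have TC: "T \<in> constructible"
  proof -
    have 1: "{e. \<forall>i\<in>{..<n}. \<forall>p\<in>{..<n}. e (1, i, p) * e (2, i, p) - 1 = (0 :: complex) \<and> e (3, i, p) * e (4, i, p) - 1 = 0} \<in> constructible"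
      unfolding Collect_conj_eq
      by (intro constructible_INT finite_lessThan) (unfold Collect_conj_eq, intro constructible_Int constructible_eq polyfun_diff polyfun_mult polyfun_var polyfun_const)
    have 2: "{e. \<forall>p\<in>{..<n}. \<forall>q\<in>{..<n}. e (0, p, q) - \<Phi> e $$ (p, q) = 0} \<in> constructible"
      by (intro constructible_INT finite_lessThan constructible_eq polyfun_diff polyfun_var \<Phi>polyfuns) auto
    show ?thesis unfolding T_def by (rule constructible_Int[OF 1 2])
  qed
  have "{e. mat n n (\<lambda>(p, q). e (0, p, q)) \<in> vand_image n s} = {e. \<exists>e'\<in>T. \<forall>w. w \<notin> V \<longrightarrow> e' w = e w}"
  proof (intro Set.set_eqI iffI)
    fix e :: "nat \<times> nat \<times> nat \<Rightarrow> complex"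
    assume "e \<in> {e. mat n n (\<lambda>(p, q). e (0, p, q)) \<in> vand_image n s}"
    then obtain y x where eq: "mat n n (\<lambda>(p, q). e (0, p, q)) = vand_prod n s y x"
      and nz: "\<And>i p. i < n \<Longrightarrow> p < n \<Longrightarrow> y i p \<noteq> 0 \<and> x i p \<noteq> 0" unfolding vand_image_def by blast
    define e' where "e' = (\<lambda>(k, i, p). if (k, i, p) \<in> V then
      if k = 1 then y i p else if k = 2 then 1 / y i p else if k = 3 then x i p else 1 / x i p else e (k, i, p))"
    have e': "e' (1, i, p) = y i p" "e' (2, i, p) = 1 / y i p" "e' (3, i, p) = x i p" "e' (4, i, p) = 1 / x i p"
      if "i < n" "p < n" for i p using that by (auto simp: e'_def V_def)
    have e'0: "e' (0, p, q) = e (0, p, q)" for p q by (simp add: e'_def V_def)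
    have "\<Phi> e' = vand_prod n s (\<lambda>i p. e' (1, i, p)) (\<lambda>i p. e' (3, i, p))"
      by (rule vp) (use e' nz in auto)
    also have "\<dots> = vand_prod n s y x"
    proof -
      have "gen_vandermonde n (s i) (\<lambda>p. e' (1, i, p)) = gen_vandermonde n (s i) (y i)"
        "gen_vandermonde n (s i) (\<lambda>p. e' (3, i, p)) = gen_vandermonde n (s i) (x i)" if "i < n" for i
        using e'[OF that] unfolding gen_vandermonde_def by (auto intro!: eq_matI)
      then show ?thesis unfolding vand_prod_def alt_prod_def
        by (intro arg_cong[where f = "\<lambda>L. foldr (*) L (1\<^sub>m n)"] map_cong refl) simp
    qed
    finally have \<Phi>e': "\<Phi> e' = mat n n (\<lambda>(p, q). e (0, p, q))" using eq by simp
    have "e' \<in> T" unfolding T_def using e' nz e'0 by (auto simp: \<Phi>e')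
    moreover have "\<forall>w. w \<notin> V \<longrightarrow> e' w = e w" by (auto simp: e'_def)
    ultimately show "e \<in> {e. \<exists>e'\<in>T. \<forall>w. w \<notin> V \<longrightarrow> e' w = e w}" by blast
  next
    fix e :: "nat \<times> nat \<times> nat \<Rightarrow> complex"
    assume "e \<in> {e. \<exists>e'\<in>T. \<forall>w. w \<notin> V \<longrightarrow> e' w = e w}"
    then obtain e' where e': "e' \<in> T" "\<And>w. w \<notin> V \<Longrightarrow> e' w = e w" by blast
    have e'0: "e' (0, p, q) = e (0, p, q)" for p q by (rule e'(2)) (simp add: V_def)
    have inv: "e' (1, i, p) * e' (2, i, p) = 1 \<and> e' (3, i, p) * e' (4, i, p) = 1" if "i < n" "p < n" for i p
      using e'(1) that unfolding T_def by auto
    then have nz: "e' (1, i, p) \<noteq> 0 \<and> e' (3, i, p) \<noteq> 0" if "i < n" "p < n" for i p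
      using that by (metis mult_zero_left zero_neq_one)
    have "mat n n (\<lambda>(p, q). e (0, p, q)) = \<Phi> e'"
      using e'(1) e'0 carrier_matD[OF \<Phi>[of e']] unfolding T_def by (intro eq_matI) auto
    also have "\<dots> = vand_prod n s (\<lambda>i p. e' (1, i, p)) (\<lambda>i p. e' (3, i, p))" by (rule vp[OF inv])
    also have "\<dots> \<in> vand_image n s" unfolding vand_image_def using nz by blast
    finally show "e \<in> {e. mat n n (\<lambda>(p, q). e (0, p, q)) \<in> vand_image n s}" by simp
  qed
  also have "\<dots> \<in> constructible" by (rule constructible_Ex_finite[OF _ TC]) (simp add: V_def)
  finally show ?thesis .
qed

text \<open>Constructibility leaves two alternatives, and the curves exclude that the image avoids a nonempty set
{F \<noteq> 0}. The function F involves the auxiliary variables of the elimination too; fixing these at a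
point where F is nonzero leaves a function of the entries alone.\<close>

lemma vand_image_contains_generic:
  assumes curve: "\<And>Z. \<exists>g. (\<forall>\<^sub>F \<epsilon> in at 0. g \<epsilon> \<in> vand_image n s) \<and>
     (\<forall>p<n. \<forall>q<n. ((\<lambda>\<epsilon>. (g \<epsilon> $$ (p, q) - I p q) / \<epsilon>\<^sup>2) \<longlongrightarrow> Z p q) (at (0 :: complex)))"
  shows "\<exists>f\<in>polyfuns. (\<exists>X. f (entries n X) \<noteq> 0) \<and>
    (\<forall>X \<in> carrier_mat n n. f (entries n X) \<noteq> 0 \<longrightarrow> X \<in> vand_image n s)"
proof -
  let ?S = "{e :: nat \<times> nat \<times> nat \<Rightarrow> complex. mat n n (\<lambda>(p, q). e (0, p, q)) \<in> vand_image n s}"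
  obtain F where F: "F \<in> polyfuns" and F': "(\<exists>e. F e \<noteq> 0) \<and> ({e. F e \<noteq> 0} \<subseteq> ?S \<or> {e. F e \<noteq> 0} \<inter> ?S = {})"
    using constructible_generic[OF constructible_vand_image, of n s] by (rule bexE)
  obtain e0 where e0: "F e0 \<noteq> 0" using F' by (rule conjE) (erule exE)
  have "\<not> {e. F e \<noteq> 0} \<inter> ?S = {}"
  proof
    assume dis: "{e. F e \<noteq> 0} \<inter> ?S = {}"
    define a where "a = (\<lambda>(k::nat, p, q). if k = 0 \<and> p < n \<and> q < n then I p q else 0)"
    have "F e0 = 0"
    proof (rule polyfun_vanish_on_curves[OF F, where a = a])
      fix z :: "nat \<times> nat \<times> nat \<Rightarrow> complex"
      obtain g where g: "\<forall>\<^sub>F \<epsilon> in at 0. g \<epsilon> \<in> vand_image n s"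
        "\<And>p q. p < n \<Longrightarrow> q < n \<Longrightarrow> ((\<lambda>\<epsilon>. (g \<epsilon> $$ (p, q) - I p q) / \<epsilon>\<^sup>2) \<longlongrightarrow> z (0, p, q)) (at 0)"
        using curve[of "\<lambda>p q. z (0, p, q)"] by blast
      define h where "h \<epsilon> = (\<lambda>(k::nat, p, q). if k = 0 \<and> p < n \<and> q < n then g \<epsilon> $$ (p, q)
        else \<epsilon>\<^sup>2 * z (k, p, q))" for \<epsilon>
      have "((\<lambda>\<epsilon>. (h \<epsilon> v - a v) / \<epsilon>\<^sup>2) \<longlongrightarrow> z v) (at 0)" for v
      proof -
        obtain k p q where v: "v = (k, p, q)" by (cases v)
        show ?thesis
        proof (cases "k = 0 \<and> p < n \<and> q < n")
          case True then show ?thesis using g(2)[of p q] by (simp add: h_def a_def v)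
        next
          case False
          have "((\<lambda>\<epsilon>. z v) \<longlongrightarrow> z v) (at (0::complex))" by (rule tendsto_const)
          moreover have "\<forall>\<^sub>F \<epsilon> in at 0. z v = (h \<epsilon> v - a v) / \<epsilon>\<^sup>2"
            using eventually_neq_at_within[of 0 0 UNIV]
            by eventually_elim (use False in \<open>auto simp: h_def a_def v\<close>)
          ultimately show ?thesis by (rule Lim_transform_eventually)
        qed
      qed
      moreover have "\<forall>\<^sub>F \<epsilon> in at 0. F (h \<epsilon>) = 0"
        using g(1)
      proof eventually_elim
        case (elim \<epsilon>)
        have "g \<epsilon> \<in> carrier_mat n n" using elim vand_prod_carrier unfolding vand_image_def by auto
        then have "mat n n (\<lambda>(p, q). h \<epsilon> (0, p, q)) = g \<epsilon>" by (intro eq_matI) (auto simp: h_def)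
        then have "h \<epsilon> \<in> ?S" using elim by simp
        then show ?case using dis by blast
      qed
      ultimately show "\<exists>g. (\<forall>v. ((\<lambda>\<epsilon>. (g \<epsilon> v - a v) / \<epsilon>\<^sup>2) \<longlongrightarrow> z v) (at 0)) \<and> (\<forall>\<^sub>F \<epsilon> in at 0. F (g \<epsilon>) = 0)"
        by (intro exI[of _ h]) simp
    qed
    then show False using e0 by simp
  qed
  then have sub: "{e. F e \<noteq> 0} \<subseteq> ?S" using F' by (rule_tac disjE[OF conjunct2[OF F']]) simp_all
  \<comment> \<open>The entries vary, and the variables of the elimination stay at e0.\<close>
  define ext where "ext e = (\<lambda>(k::nat, p, q). if k = 0 \<and> p < n \<and> q < n then e (p, q) else e0 (k, p, q))"
    for e :: "nat \<times> nat \<Rightarrow> complex"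
  define f where "f e = F (ext e)" for e
  have "f \<in> polyfuns" unfolding f_def
  proof (rule polyfun_subst[OF F])
    fix v :: "nat \<times> nat \<times> nat"
    obtain k p q where v: "v = (k, p, q)" by (cases v)
    show "(\<lambda>e. ext e v) \<in> polyfuns"
      by (cases "k = 0 \<and> p < n \<and> q < n") (auto simp: ext_def v polyfun_const polyfun_var)
  qed
  moreover have "f (entries n (mat n n (\<lambda>(p, q). e0 (0, p, q)))) \<noteq> 0"
  proof -
    have "ext (entries n (mat n n (\<lambda>(p, q). e0 (0, p, q)))) = e0"
      by (auto simp: ext_def entries_def fun_eq_iff)
    then show ?thesis using e0 by (simp add: f_def)
  qed
  moreover have "X \<in> vand_image n s" if X: "X \<in> carrier_mat n n" "f (entries n X) \<noteq> 0" for X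
  proof -
    have "ext (entries n X) \<in> ?S" using X(2) sub unfolding f_def by auto
    moreover have "mat n n (\<lambda>(p, q). ext (entries n X) (0, p, q)) = X"
      using X(1) by (intro eq_matI) (auto simp: ext_def entries_def)
    ultimately show ?thesis by simp
  qed
  ultimately show ?thesis by (intro bexI[where x = f]) auto
qed

lemma invertible_vand_products:
  assumes f: "f \<in> polyfuns" "f (entries n X0) \<noteq> 0"
    "\<forall>X \<in> carrier_mat n n. f (entries n X) \<noteq> 0 \<longrightarrow> X \<in> vand_image n s"
    and M: "M \<in> carrier_mat n n" "det M \<noteq> 0"
  shows "\<exists>A A' B B'. (\<forall>i<n. A i \<in> Vand n (s i) \<and> A' i \<in> Vand n (s i) \<and>
               B i \<in> VandT n (s i) \<and> B' i \<in> VandT n (s i)) \<and>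
        M = alt_prod n B A * alt_prod n B' A' \<and>
        alt_prod n B A \<in> carrier_mat n n \<and> alt_prod n B' A' \<in> carrier_mat n n"
proof -
  obtain X Y where XY: "X \<in> carrier_mat n n" "Y \<in> carrier_mat n n" "M = X * Y"
     "f (entries n X) \<noteq> 0" "f (entries n Y) \<noteq> 0"
    using invertible_product_of_generic[OF f(1,2) M] by blast
  obtain A B where AB: "\<forall>i<n. A i \<in> Vand n (s i) \<and> B i \<in> VandT n (s i)" "X = alt_prod n B A"
    using vand_imageD[OF mp[OF bspec[OF f(3) XY(1)] XY(4)]] by blast
  obtain A' B' where AB': "\<forall>i<n. A' i \<in> Vand n (s i) \<and> B' i \<in> VandT n (s i)" "Y = alt_prod n B' A'"
    using vand_imageD[OF mp[OF bspec[OF f(3) XY(2)] XY(5)]] by blast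
  show ?thesis using AB AB' XY(1-3) by (intro exI[of _ A] exI[of _ A'] exI[of _ B] exI[of _ B']) auto
qed

section \<open>Additive characters modulo n\<close>

text \<open>The character d \<mapsto> \<omega>^d of the integers modulo n, where \<omega> is the primitive root of unity
exp(2 \<pi> \<i> / n).\<close>

definition character :: "nat \<Rightarrow> int \<Rightarrow> complex" where
  "character n d = cis (2 * pi * of_int d / of_nat n)"

lemma character_0 [simp]: "character n 0 = 1"
  by (simp add: character_def)

lemma character_add: "character n (a + b) = character n a * character n b"
  by (simp add: character_def cis_mult ring_distribs add_divide_distrib)

lemma character_nonzero [simp]: "character n a \<noteq> 0"
  by (simp add: character_def)

lemma cnj_character: "cnj (character n a) = character n (- a)"
  by (simp add: character_def cis_cnj)

lemma character_powi: "character n a powi j = character n (a * j)"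
  by (simp add: character_def cis_power_int mult_ac)

lemma character_power: "character n a ^ k = character n (a * int k)"
  using character_powi[of n a "int k"] by simp

lemma character_eq_1_iff:
  assumes "0 < n" shows "character n a = 1 \<longleftrightarrow> int n dvd a"
proof
  assume "character n a = 1"
  then have "cos (2 * pi * of_int a / of_nat n) = 1"
    by (simp add: character_def complex_eq_iff)
  then obtain k :: int where "2 * pi * of_int a / of_nat n = of_int k * 2 * pi"
    using cos_one_2pi_int by blast
  then have "of_int a = (of_int (k * int n) :: real)" using assms by (simp add: field_simps)
  then have "a = k * int n" by (simp only: of_int_eq_iff)
  then show "int n dvd a" by simp
next
  assume "int n dvd a"
  then obtain k where "a = int n * k" by blast
  then have "2 * pi * of_int a / of_nat n = 2 * pi * of_int k" using assms by simp
  then show "character n a = 1" unfolding character_def by (simp only: cis_multiple_2pi Ints_of_int)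
qed

lemma character_cong:
  assumes "0 < n" "int n dvd a - b" shows "character n a = character n b"
  using character_add[of n b "a - b"] character_eq_1_iff[OF assms(1), of "a - b"] assms(2) by simp

lemma sum_character:
  assumes "0 < n" shows "(\<Sum>k<n. character n (a * int k)) = (if int n dvd a then of_nat n else 0)"
proof (cases "int n dvd a")
  case True
  then have "character n (a * int k) = 1" for k using character_eq_1_iff[OF assms] by simp
  then show ?thesis using True by simp
next
  case False
  then have ne: "character n a \<noteq> 1" using character_eq_1_iff[OF assms] by simp
  have "(character n a - 1) * (\<Sum>k<n. character n a ^ k) = character n a ^ n - 1" by (simp add: power_diff_1_eq)
  also have "character n a ^ n = 1" using character_eq_1_iff[OF assms] by (simp add: character_power)
  finally show ?thesis using ne False by (simp add: character_power)
qed

lemma bij_betw_residues: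
  fixes t :: "nat \<Rightarrow> int"
  assumes n: "0 < n" and inc: "\<And>i j. i < n \<Longrightarrow> j < n \<Longrightarrow> int n dvd t i - t j \<Longrightarrow> i = j"
  shows "bij_betw (\<lambda>i. nat (t i mod int n)) {..<n} {..<n}"
proof -
  let ?g = "\<lambda>i. nat (t i mod int n)"
  have g: "int (?g i) = t i mod int n" for i using n by simp
  have "inj_on ?g {..<n}"
  proof (rule inj_onI)
    fix i j assume ij: "i \<in> {..<n}" "j \<in> {..<n}" "?g i = ?g j"
    then have "t i mod int n = t j mod int n" using g by metis
    then have "int n dvd t i - t j" by (simp add: mod_eq_dvd_iff)
    then show "i = j" using inc ij by simp
  qed
  moreover have "?g ` {..<n} \<subseteq> {..<n}" using n by (auto simp: nat_less_iff)
  ultimately show ?thesis by (simp add: bij_betw_def endo_inj_surj)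
qed

lemma sum_complete_residues:
  fixes f :: "int \<Rightarrow> complex" and t :: "nat \<Rightarrow> int"
  assumes n: "0 < n"
    and periodic: "\<And>x y. int n dvd x - y \<Longrightarrow> f x = f y"
    and inc: "\<And>i j. i < n \<Longrightarrow> j < n \<Longrightarrow> int n dvd t i - t j \<Longrightarrow> i = j"
  shows "(\<Sum>i<n. f (t i)) = (\<Sum>r<n. f (int r))"
proof -
  have "(\<Sum>r<n. f (int r)) = (\<Sum>i<n. f (int (nat (t i mod int n))))"
    by (rule sum.reindex_bij_betw[OF bij_betw_residues[OF n inc], symmetric])
  also have "\<dots> = (\<Sum>i<n. f (t i))"
    using n by (intro sum.cong refl periodic) (simp add: mod_eq_dvd_iff[symmetric])
  finally show ?thesis by simp
qed

text \<open>For r = \<omega>^d one has r^n = 1, so summing the differences of (c + k) r^k telescopes to n, while the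
sum of r^k alone vanishes.\<close>

lemma sum_linear_character:
  assumes n: "0 < n" and d: "\<not> int n dvd d"
  shows "(\<Sum>k<n. (c + of_nat k) * character n (d * int k)) = of_nat n / (character n d - 1)"
proof -
  define r where "r = character n d"
  have r: "r \<noteq> 1" using character_eq_1_iff[OF n] d by (simp add: r_def)
  have rn: "r ^ n = 1" using character_eq_1_iff[OF n] by (simp add: r_def character_power)
  have S0: "(\<Sum>k<n. r ^ k) = 0" using sum_character[OF n, of d] d by (simp add: r_def character_power)
  define S where "S = (\<Sum>k<n. (c + of_nat k) * r ^ k)"
  have "(r - 1) * S + r * (\<Sum>k<n. r ^ k) = (\<Sum>k<n. (c + of_nat (Suc k)) * r ^ Suc k - (c + of_nat k) * r ^ k)"
    unfolding S_def sum_distrib_left sum.distrib[symmetric] by (intro sum.cong refl) (simp add: algebra_simps)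
  also have "\<dots> = of_nat n"
    by (subst sum_lessThan_telescope[where f = "\<lambda>k. (c + of_nat k) * r ^ k"]) (simp add: rn)
  finally show ?thesis using r S0 unfolding S_def r_def character_power by (simp add: field_simps)
qed

text \<open>The same telescoping for (c + k)^2 r^k, which reduces to the linear sum.\<close>

lemma sum_quadratic_character:
  assumes n: "0 < n" and d: "\<not> int n dvd d"
  shows "(\<Sum>k<n. (c + of_nat k)\<^sup>2 * character n (d * int k)) =
    of_nat n * (2 * c + of_nat n - 2 - 2 / (character n d - 1)) / (character n d - 1)"
proof -
  define r where "r = character n d"
  have r: "r - 1 \<noteq> 0" using character_eq_1_iff[OF n] d by (simp add: r_def)
  have rn: "r ^ n = 1" using character_eq_1_iff[OF n] by (simp add: r_def character_power)
  have S0: "(\<Sum>k<n. r ^ k) = 0" using sum_character[OF n, of d] d by (simp add: r_def character_power)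
  have S1: "(\<Sum>k<n. (c + of_nat k) * r ^ k) = of_nat n / (r - 1)"
    using sum_linear_character[OF n d, of c] by (simp add: r_def character_power)
  define S where "S = (\<Sum>k<n. (c + of_nat k)\<^sup>2 * r ^ k)"
  have "(r - 1) * S + 2 * r * (\<Sum>k<n. (c + of_nat k) * r ^ k) + r * (\<Sum>k<n. r ^ k)
      = (\<Sum>k<n. (c + of_nat (Suc k))\<^sup>2 * r ^ Suc k - (c + of_nat k)\<^sup>2 * r ^ k)"
    unfolding S_def sum_distrib_left sum.distrib[symmetric]
    by (intro sum.cong refl) (simp add: algebra_simps power2_eq_square)
  also have "\<dots> = of_nat n * (2 * c + of_nat n)"
    by (subst sum_lessThan_telescope[where f = "\<lambda>k. (c + of_nat k)\<^sup>2 * r ^ k"])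
      (simp add: rn power2_eq_square algebra_simps)
  finally have "(r - 1) * S = of_nat n * (2 * c + of_nat n) - 2 * r * of_nat n / (r - 1)"
    using S0 S1 by (simp add: algebra_simps)
  also have "2 * r * of_nat n / (r - 1) = of_nat n * (2 + 2 / (r - 1))"
    using r by (simp add: field_simps)
  finally have "(r - 1) * S = of_nat n * (2 * c + of_nat n - 2 - 2 / (r - 1))"
    by (simp add: algebra_simps)
  then have "S = of_nat n * (2 * c + of_nat n - 2 - 2 / (r - 1)) / (r - 1)"
    using r by (simp add: eq_divide_eq mult.commute)
  then show ?thesis unfolding S_def r_def character_power .
qed

section \<open>Expansions of order two\<close>

text \<open>This says f \<epsilon> = a + b \<epsilon> + c \<epsilon>^2 + o(\<epsilon>^2) as \<epsilon> tends to 0.\<close>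

definition expansion2 :: "(complex \<Rightarrow> complex) \<Rightarrow> complex \<Rightarrow> complex \<Rightarrow> complex \<Rightarrow> bool" where
  "expansion2 f a b c \<longleftrightarrow> ((\<lambda>\<epsilon>. (f \<epsilon> - (a + \<epsilon> * b)) / \<epsilon>\<^sup>2) \<longlongrightarrow> c) (at 0)"

lemma expansion2_cong:
  "expansion2 f a b c \<Longrightarrow> f = f' \<Longrightarrow> a = a' \<Longrightarrow> b = b' \<Longrightarrow> c = c' \<Longrightarrow> expansion2 f' a' b' c'"
  by simp

lemma expansion2_const: "expansion2 (\<lambda>\<epsilon>. a) a 0 0"
  by (simp add: expansion2_def)

lemma expansion2_add:
  assumes "expansion2 f a b c" "expansion2 g a' b' c'"
  shows "expansion2 (\<lambda>\<epsilon>. f \<epsilon> + g \<epsilon>) (a + a') (b + b') (c + c')"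
proof -
  have "((\<lambda>\<epsilon>. (f \<epsilon> - (a + \<epsilon> * b)) / \<epsilon>\<^sup>2 + (g \<epsilon> - (a' + \<epsilon> * b')) / \<epsilon>\<^sup>2) \<longlongrightarrow> c + c') (at 0)"
    using assms unfolding expansion2_def by (intro tendsto_intros)
  also have "(\<lambda>\<epsilon>. (f \<epsilon> - (a + \<epsilon> * b)) / \<epsilon>\<^sup>2 + (g \<epsilon> - (a' + \<epsilon> * b')) / \<epsilon>\<^sup>2)
      = (\<lambda>\<epsilon>. (f \<epsilon> + g \<epsilon> - (a + a' + \<epsilon> * (b + b'))) / \<epsilon>\<^sup>2)"
    by (simp add: fun_eq_iff add_divide_distrib[symmetric] algebra_simps)
  finally show ?thesis unfolding expansion2_def .
qed

lemma expansion2_tendsto: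
  assumes "expansion2 f a b c" shows "(f \<longlongrightarrow> a) (at 0)"
proof -
  have "((\<lambda>\<epsilon>. a + \<epsilon> * b + \<epsilon>\<^sup>2 * ((f \<epsilon> - (a + \<epsilon> * b)) / \<epsilon>\<^sup>2)) \<longlongrightarrow> a + 0 * b + 0\<^sup>2 * c) (at 0)"
    using assms unfolding expansion2_def by (intro tendsto_intros)
  moreover have "\<forall>\<^sub>F \<epsilon> in at 0. a + \<epsilon> * b + \<epsilon>\<^sup>2 * ((f \<epsilon> - (a + \<epsilon> * b)) / \<epsilon>\<^sup>2) = f \<epsilon>"
    using eventually_neq_at_within[of 0 0 UNIV] by eventually_elim simp
  ultimately have "(f \<longlongrightarrow> a + 0 * b + 0\<^sup>2 * c) (at 0)" by (rule Lim_transform_eventually)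
  then show ?thesis by simp
qed

lemma expansion2_mult:
  assumes f: "expansion2 f a b c" and g: "expansion2 g a' b' c'"
  shows "expansion2 (\<lambda>\<epsilon>. f \<epsilon> * g \<epsilon>) (a * a') (a * b' + b * a') (a * c' + b * b' + c * a')"
proof -
  let ?F = "\<lambda>\<epsilon>. (f \<epsilon> - (a + \<epsilon> * b)) / \<epsilon>\<^sup>2" and ?G = "\<lambda>\<epsilon>. (g \<epsilon> - (a' + \<epsilon> * b')) / \<epsilon>\<^sup>2"
  have "((\<lambda>\<epsilon>. ?F \<epsilon> * g \<epsilon> + (a + \<epsilon> * b) * ?G \<epsilon> + b * b') \<longlongrightarrow> c * a' + (a + 0 * b) * c' + b * b') (at 0)"
    using f g expansion2_tendsto[OF g] unfolding expansion2_def by (intro tendsto_intros)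
  moreover have "\<forall>\<^sub>F \<epsilon> in at 0. ?F \<epsilon> * g \<epsilon> + (a + \<epsilon> * b) * ?G \<epsilon> + b * b'
      = (f \<epsilon> * g \<epsilon> - (a * a' + \<epsilon> * (a * b' + b * a'))) / \<epsilon>\<^sup>2"
    using eventually_neq_at_within[of 0 0 UNIV]
  proof eventually_elim
    case (elim \<epsilon>)
    then show ?case by (simp add: field_simps power2_eq_square)
  qed
  ultimately have "((\<lambda>\<epsilon>. (f \<epsilon> * g \<epsilon> - (a * a' + \<epsilon> * (a * b' + b * a'))) / \<epsilon>\<^sup>2)
      \<longlongrightarrow> c * a' + (a + 0 * b) * c' + b * b') (at 0)" by (rule Lim_transform_eventually)
  then show ?thesis unfolding expansion2_def by (simp add: algebra_simps)
qed

lemma expansion2_cmult: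
  assumes "expansion2 f a b c" shows "expansion2 (\<lambda>\<epsilon>. k * f \<epsilon>) (k * a) (k * b) (k * c)"
  using expansion2_mult[OF expansion2_const[of k] assms] by simp

lemma expansion2_sum:
  assumes "\<And>i. i \<in> I \<Longrightarrow> expansion2 (f i) (a i) (b i) (c i)"
  shows "expansion2 (\<lambda>\<epsilon>. \<Sum>i\<in>I. f i \<epsilon>) (\<Sum>i\<in>I. a i) (\<Sum>i\<in>I. b i) (\<Sum>i\<in>I. c i)"
  using assms
  by (induction I rule: infinite_finite_induct) (auto intro: expansion2_const expansion2_add)

text \<open>The quotient is the power series with coefficients 1 / (n + 2)!, and a power series tends to
its constant coefficient.\<close>

lemma exp_second_order: "((\<lambda>z. (exp z - (1 + z)) / z\<^sup>2) \<longlongrightarrow> 1 / 2) (at (0 :: complex))"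
proof -
  have "((\<lambda>z. (exp z - (1 + z)) / z\<^sup>2) \<longlongrightarrow> (\<lambda>n. 1 / fact (n + 2) :: complex) 0) (at 0)"
  proof (rule powser_limit_0_strong[of 1])
    fix z :: complex assume z: "z \<noteq> 0"
    have "(\<lambda>n. z ^ n /\<^sub>R fact n) sums exp z" by (rule exp_converges)
    then have "(\<lambda>n. z ^ (n + 2) /\<^sub>R fact (n + 2)) sums (exp z - (\<Sum>i<2. z ^ i /\<^sub>R fact i))"
      by (rule sums_split_initial_segment)
    then have sums: "(\<lambda>n. z ^ (n + 2) /\<^sub>R fact (n + 2) / z\<^sup>2) sums ((exp z - (\<Sum>i<2. z ^ i /\<^sub>R fact i)) / z\<^sup>2)"
      by (rule sums_divide)
    have quotient: "z ^ (n + 2) /\<^sub>R c / z\<^sup>2 = 1 / of_real c * z ^ n" for n c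
      using z by (simp add: scaleR_conv_of_real power_add power2_eq_square field_simps)
    have "(\<Sum>i<2. z ^ i /\<^sub>R fact i) = 1 + z" by (simp add: numeral_2_eq_2)
    with sums show "(\<lambda>n. 1 / fact (n + 2) * z ^ n) sums ((exp z - (1 + z)) / z\<^sup>2)"
      by (simp only: quotient of_real_fact)
  qed simp
  then show ?thesis by (simp add: numeral_2_eq_2)
qed

lemma expansion2_exp_linear: "expansion2 (\<lambda>\<epsilon>. exp (\<epsilon> * \<gamma>)) 1 \<gamma> (\<gamma>\<^sup>2 / 2)"
proof (cases "\<gamma> = 0")
  case True then show ?thesis by (simp add: expansion2_const)
next
  case False
  have "filterlim (\<lambda>\<epsilon>. \<epsilon> * \<gamma>) (at 0) (at 0)"
    unfolding filterlim_at using False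
    by (auto intro!: tendsto_eq_intros simp: eventually_at_filter)
  from filterlim_compose[OF exp_second_order this]
  have "((\<lambda>\<epsilon>. (exp (\<epsilon> * \<gamma>) - (1 + \<epsilon> * \<gamma>)) / (\<epsilon> * \<gamma>)\<^sup>2 * \<gamma>\<^sup>2) \<longlongrightarrow> 1 / 2 * \<gamma>\<^sup>2) (at 0)"
    by (rule tendsto_mult[OF _ tendsto_const])
  moreover have "(exp (\<epsilon> * \<gamma>) - (1 + \<epsilon> * \<gamma>)) / (\<epsilon> * \<gamma>)\<^sup>2 * \<gamma>\<^sup>2 = (exp (\<epsilon> * \<gamma>) - (1 + \<epsilon> * \<gamma>)) / \<epsilon>\<^sup>2" for \<epsilon>
    using False by (simp add: power_mult_distrib)
  ultimately show ?thesis unfolding expansion2_def by simp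
qed

lemma expansion2_exp_square: "expansion2 (\<lambda>\<epsilon>. exp (\<epsilon>\<^sup>2 * \<delta>)) 1 0 \<delta>"
proof -
  have lim: "((\<lambda>\<epsilon>. \<epsilon>\<^sup>2) \<longlongrightarrow> 0) (at (0::complex))" by (auto intro!: tendsto_eq_intros)
  have "filterlim (\<lambda>\<epsilon>. \<epsilon>\<^sup>2) (at 0) (at (0::complex))"
    unfolding filterlim_at using lim by (auto simp: eventually_at_filter)
  from filterlim_compose[OF expansion2_exp_linear[of \<delta>, unfolded expansion2_def] this]
  have "((\<lambda>\<epsilon>. \<delta> + \<epsilon>\<^sup>2 * ((exp (\<epsilon>\<^sup>2 * \<delta>) - (1 + \<epsilon>\<^sup>2 * \<delta>)) / (\<epsilon>\<^sup>2)\<^sup>2)) \<longlongrightarrow> \<delta> + 0 * (\<delta>\<^sup>2 / 2)) (at 0)"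
    by (rule tendsto_add[OF tendsto_const tendsto_mult[OF lim]])
  moreover have "\<forall>\<^sub>F \<epsilon> in at (0::complex). \<delta> + \<epsilon>\<^sup>2 * ((exp (\<epsilon>\<^sup>2 * \<delta>) - (1 + \<epsilon>\<^sup>2 * \<delta>)) / (\<epsilon>\<^sup>2)\<^sup>2)
     = (exp (\<epsilon>\<^sup>2 * \<delta>) - (1 + \<epsilon> * 0)) / \<epsilon>\<^sup>2"
    using eventually_neq_at_within[of 0 0 UNIV]
    by eventually_elim (simp add: field_simps power2_eq_square)
  ultimately have "((\<lambda>\<epsilon>. (exp (\<epsilon>\<^sup>2 * \<delta>) - (1 + \<epsilon> * 0)) / \<epsilon>\<^sup>2) \<longlongrightarrow> \<delta> + 0 * (\<delta>\<^sup>2 / 2)) (at 0)"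
    by (rule Lim_transform_eventually)
  then show ?thesis unfolding expansion2_def by simp
qed

lemma expansion2_exp:
  "expansion2 (\<lambda>\<epsilon>. exp (j * (\<epsilon> * \<alpha> + \<epsilon>\<^sup>2 * \<beta>))) 1 (j * \<alpha>) (j * \<beta> + (j * \<alpha>)\<^sup>2 / 2)"
proof (rule expansion2_cong[OF expansion2_mult[OF expansion2_exp_linear expansion2_exp_square]])
  show "(\<lambda>\<epsilon>. exp (\<epsilon> * (j * \<alpha>)) * exp (\<epsilon>\<^sup>2 * (j * \<beta>))) = (\<lambda>\<epsilon>. exp (j * (\<epsilon> * \<alpha> + \<epsilon>\<^sup>2 * \<beta>)))"
    by (simp add: exp_add[symmetric] algebra_simps)
qed simp_all

text \<open>The product of the matrices c (1 + \<epsilon> T_i + \<epsilon>^2 U_i) has first-order coefficient the sum of the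
T_i. Its second-order coefficient is the sum of the U_i plus the sum of T_i T_j over all i before j,
and W computes the latter by recursion on the list of factors.\<close>

lemma foldr_mult_expansion2:
  fixes G :: "nat \<Rightarrow> complex \<Rightarrow> complex mat"
  assumes carrier: "\<And>i \<epsilon>. G i \<epsilon> \<in> carrier_mat n n"
    and G: "\<And>i p q. p < n \<Longrightarrow> q < n \<Longrightarrow> expansion2 (\<lambda>\<epsilon>. G i \<epsilon> $$ (p, q))
      (if p = q then c else 0) (c * T i p q) (c * U i p q)"
    and W: "\<And>p q. W [] p q = 0"
      "\<And>i js p q. W (i # js) p q = W js p q + (\<Sum>r<n. T i p r * (\<Sum>j\<leftarrow>js. T j r q))"
    and pq: "p < n" "q < n"
  shows "expansion2 (\<lambda>\<epsilon>. foldr (*) (map (\<lambda>i. G i \<epsilon>) js) (1\<^sub>m n) $$ (p, q))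
     (if p = q then c ^ length js else 0) (c ^ length js * (\<Sum>j\<leftarrow>js. T j p q))
     (c ^ length js * ((\<Sum>j\<leftarrow>js. U j p q) + W js p q))"
  using pq
proof (induction js arbitrary: p q)
  case Nil
  then show ?case by (simp add: W expansion2_const)
next
  case (Cons i js)
  let ?P = "\<lambda>\<epsilon>. foldr (*) (map (\<lambda>i. G i \<epsilon>) js) (1\<^sub>m n)"
  let ?m = "length js"
  have "expansion2 (\<lambda>\<epsilon>. \<Sum>r<n. G i \<epsilon> $$ (p, r) * ?P \<epsilon> $$ (r, q))
    (\<Sum>r<n. (if p = r then c else 0) * (if r = q then c ^ ?m else 0))
    (\<Sum>r<n. (if p = r then c else 0) * (c ^ ?m * (\<Sum>j\<leftarrow>js. T j r q)) + (c * T i p r) * (if r = q then c ^ ?m else 0))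
    (\<Sum>r<n. (if p = r then c else 0) * (c ^ ?m * ((\<Sum>j\<leftarrow>js. U j r q) + W js r q))
      + (c * T i p r) * (c ^ ?m * (\<Sum>j\<leftarrow>js. T j r q)) + (c * U i p r) * (if r = q then c ^ ?m else 0))"
    by (intro expansion2_sum expansion2_mult G Cons.IH) (use Cons.prems in auto)
  then show ?case
  proof (rule expansion2_cong)
    show "(\<lambda>\<epsilon>. \<Sum>r<n. G i \<epsilon> $$ (p, r) * ?P \<epsilon> $$ (r, q)) =
        (\<lambda>\<epsilon>. foldr (*) (map (\<lambda>i. G i \<epsilon>) (i # js)) (1\<^sub>m n) $$ (p, q))"
      unfolding list.map foldr_Cons o_apply
      by (intro ext, rule mult_mat_entry[OF carrier foldr_mult_carrier[OF carrier] Cons.prems, symmetric])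
    have pick_l: "(\<Sum>r<n. (if p = r then c else 0) * f r) = c * f p" for f :: "nat \<Rightarrow> complex"
      using Cons.prems(1) by (subst sum.remove[of _ p]) (auto intro!: sum.neutral)
    have pick_r: "(\<Sum>r<n. f r * (if r = q then d else 0)) = f q * d" for f :: "nat \<Rightarrow> complex" and d
      using Cons.prems(2) by (subst sum.remove[of _ q]) (auto intro!: sum.neutral)
    show "(\<Sum>r<n. (if p = r then c else 0) * (if r = q then c ^ ?m else 0)) = (if p = q then c ^ length (i # js) else 0)"
      unfolding pick_l by simp
    show "(\<Sum>r<n. (if p = r then c else 0) * (c ^ ?m * (\<Sum>j\<leftarrow>js. T j r q)) + (c * T i p r) * (if r = q then c ^ ?m else 0))
      = c ^ length (i # js) * (\<Sum>j\<leftarrow>i # js. T j p q)"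
      unfolding sum.distrib pick_l pick_r by (simp add: algebra_simps)
    have "(\<Sum>r<n. (c * T i p r) * (c ^ ?m * (\<Sum>j\<leftarrow>js. T j r q)))
        = c ^ length (i # js) * (\<Sum>r<n. T i p r * (\<Sum>j\<leftarrow>js. T j r q))"
      unfolding sum_distrib_left by (intro sum.cong refl) simp
    then show "(\<Sum>r<n. (if p = r then c else 0) * (c ^ ?m * ((\<Sum>j\<leftarrow>js. U j r q) + W js r q))
      + (c * T i p r) * (c ^ ?m * (\<Sum>j\<leftarrow>js. T j r q)) + (c * U i p r) * (if r = q then c ^ ?m else 0))
      = c ^ length (i # js) * ((\<Sum>j\<leftarrow>i # js. U j p q) + W (i # js) p q)"
      unfolding sum.distrib pick_l pick_r W by (simp add: algebra_simps)
  qed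
qed

section \<open>The product of Vandermonde matrices near the Fourier nodes\<close>

text \<open>The types s_i represent each residue modulo n exactly once. In this context \<sigma> i is the mean of the n
exponents that occur in a matrix of type s_i, \<kappa> is the sum of these means, and \<tau> is their
Fourier transform, each mean being placed at the residue of s_i. Further, moment1 and moment2 are
the Fourier sums over the exponents e of type s_i, weighted by e and by e^2. They are the coefficients of
the first two derivatives of B_i A_i / n at the roots of unity.\<close>

locale residue_system =
  fixes n :: nat and s :: "nat \<Rightarrow> int"
  assumes n_pos: "0 < n"
    and incongruent: "\<And>i j. i < n \<Longrightarrow> j < n \<Longrightarrow> int n dvd s i - s j \<Longrightarrow> i = j"
begin

definition \<sigma> :: "nat \<Rightarrow> complex" where "\<sigma> i = of_int (s i) + (of_nat n - 1) / 2"
definition \<kappa> :: complex where "\<kappa> = (\<Sum>i<n. \<sigma> i)"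
definition \<tau> :: "int \<Rightarrow> complex" where "\<tau> d = (\<Sum>i<n. \<sigma> i * character n (d * s i))"
definition moment1 :: "nat \<Rightarrow> int \<Rightarrow> complex" where
  "moment1 i d = (\<Sum>k<n. (of_int (s i) + of_nat k) * character n (d * (s i + int k))) / of_nat n"
definition moment2 :: "nat \<Rightarrow> int \<Rightarrow> complex" where
  "moment2 i d = (\<Sum>k<n. (of_int (s i) + of_nat k)\<^sup>2 * character n (d * (s i + int k))) / of_nat n"

lemma \<kappa>_eq: "\<kappa> = of_int (\<Sum>i<n. s i) + of_nat n * ((of_nat n - 1) / 2)"
  by (simp add: \<kappa>_def \<sigma>_def sum.distrib)

lemma character_1: "int n dvd d \<Longrightarrow> character n d = 1"
  by (simp add: character_eq_1_iff[OF n_pos])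

lemma character_ne_1: "\<not> int n dvd d \<Longrightarrow> character n d - 1 \<noteq> 0"
  by (simp add: character_eq_1_iff[OF n_pos])

lemma not_dvd_diff: "p < n \<Longrightarrow> q < n \<Longrightarrow> p \<noteq> q \<Longrightarrow> \<not> int n dvd int q - int p"
  using dvd_imp_le_int[of "int q - int p" "int n"] by auto

lemma sum_character_s: "(\<Sum>i<n. character n (d * s i)) = (if int n dvd d then of_nat n else 0)"
proof -
  have "(\<Sum>i<n. character n (d * s i)) = (\<Sum>r<n. character n (d * int r))"
    by (rule sum_complete_residues[OF n_pos _ incongruent])
      (auto intro!: character_cong[OF n_pos] simp: right_diff_distrib[symmetric])
  then show ?thesis by (simp add: sum_character[OF n_pos])
qed

lemma moment1_off: assumes "\<not> int n dvd d" shows "moment1 i d = character n (d * s i) / (character n d - 1)"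
proof -
  have "moment1 i d = character n (d * s i) * (\<Sum>k<n. (of_int (s i) + of_nat k) * character n (d * int k)) / of_nat n"
    unfolding moment1_def sum_distrib_left
    by (intro arg_cong[where f = "\<lambda>x. x / of_nat n"] sum.cong refl) (simp add: ring_distribs character_add)
  then show ?thesis using n_pos by (simp add: sum_linear_character[OF n_pos assms])
qed

lemma moment1_0: assumes "int n dvd d" shows "moment1 i d = \<sigma> i"
proof -
  have "moment1 i d = (\<Sum>k<n. of_int (s i) + of_nat k) / of_nat n"
    unfolding moment1_def using assms by (simp add: character_1)
  also have "(\<Sum>k<n. of_int (s i) + of_nat k :: complex) = of_nat n * \<sigma> i"
  proof -
    have "2 * (\<Sum>k<m. of_nat k :: complex) = of_nat m * (of_nat m - 1)" for m
      by (induction m) (simp_all add: algebra_simps)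
    from this[of n] show ?thesis by (simp add: sum.distrib \<sigma>_def field_simps)
  qed
  finally show ?thesis using n_pos by simp
qed

lemma moment2_off: assumes "\<not> int n dvd d"
  shows "moment2 i d = character n (d * s i) * (2 * \<sigma> i - 1 - 2 / (character n d - 1)) / (character n d - 1)"
proof -
  have "moment2 i d = character n (d * s i) * (\<Sum>k<n. (of_int (s i) + of_nat k)\<^sup>2 * character n (d * int k)) / of_nat n"
    unfolding moment2_def sum_distrib_left
    by (intro arg_cong[where f = "\<lambda>x. x / of_nat n"] sum.cong refl) (simp add: ring_distribs character_add)
  moreover have "2 * of_int (s i) + of_nat n - 2 = 2 * \<sigma> i - 1" by (simp add: \<sigma>_def field_simps)
  ultimately show ?thesis using n_pos by (simp add: sum_quadratic_character[OF n_pos assms])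
qed

lemma moment1_periodic: "int n dvd x - y \<Longrightarrow> moment1 i x = moment1 i y"
  unfolding moment1_def
  by (intro arg_cong[where f = "\<lambda>x. x / of_nat n"] sum.cong refl arg_cong2[where f = "(*)"] character_cong[OF n_pos])
    (simp add: left_diff_distrib[symmetric])

lemma sum_moment1: "(\<Sum>i<n. moment1 i d) = (if int n dvd d then \<kappa> else 0)"
proof (cases "int n dvd d")
  case True then show ?thesis by (simp add: moment1_0 \<kappa>_def)
next
  case False
  then show ?thesis by (simp add: moment1_off sum_divide_distrib[symmetric] sum_character_s)
qed

lemma sum_moment2_off:
  assumes "\<not> int n dvd d" shows "(\<Sum>i<n. moment2 i d) = 2 * \<tau> d / (character n d - 1)"
proof -
  have "(\<Sum>i<n. moment2 i d) = (\<Sum>i<n. (2 * (\<sigma> i * character n (d * s i)) - (1 + 2 / (character n d - 1)) * character n (d * s i)) / (character n d - 1))"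
    unfolding moment2_off[OF assms] by (intro sum.cong refl arg_cong[where f = "\<lambda>x. x / (character n d - 1)"]) (simp add: algebra_simps)
  also have "\<dots> = (2 * \<tau> d - (1 + 2 / (character n d - 1)) * (\<Sum>i<n. character n (d * s i))) / (character n d - 1)"
    by (simp only: sum_divide_distrib[symmetric] sum_subtractf sum_distrib_left[symmetric] \<tau>_def)
  finally show ?thesis using assms by (simp add: sum_character_s)
qed

text \<open>The matrices that occur, up to the factor n^n, as first derivatives of the product at the roots of
unity, when the nodes of B_i and A_i move logarithmically at the rates u i and v i.\<close>

definition linear_image :: "(nat \<Rightarrow> nat \<Rightarrow> complex) \<Rightarrow> bool" where
  "linear_image Z \<longleftrightarrow> (\<exists>u v. \<forall>p<n. \<forall>q<n. Z p q = (\<Sum>i<n. (u i p + v i q) * moment1 i (int q - int p)))"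

lemma linear_imageI:
  "(\<And>p q. p < n \<Longrightarrow> q < n \<Longrightarrow> Z p q = (\<Sum>i<n. (u i p + v i q) * moment1 i (int q - int p))) \<Longrightarrow> linear_image Z"
  unfolding linear_image_def by blast

lemma linear_image_cong:
  assumes "linear_image Z" "\<And>p q. p < n \<Longrightarrow> q < n \<Longrightarrow> Z' p q = Z p q" shows "linear_image Z'"
  using assms unfolding linear_image_def by simp

lemma linear_image_add:
  assumes "linear_image Z" "linear_image Z'" shows "linear_image (\<lambda>p q. Z p q + Z' p q)"
proof -
  obtain u v where uv: "\<And>p q. p < n \<Longrightarrow> q < n \<Longrightarrow> Z p q = (\<Sum>i<n. (u i p + v i q) * moment1 i (int q - int p))"
    using assms(1) unfolding linear_image_def by blast
  obtain u' v' where uv': "\<And>p q. p < n \<Longrightarrow> q < n \<Longrightarrow> Z' p q = (\<Sum>i<n. (u' i p + v' i q) * moment1 i (int q - int p))"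
    using assms(2) unfolding linear_image_def by blast
  show ?thesis
    by (rule linear_imageI[where u = "\<lambda>i p. u i p + u' i p" and v = "\<lambda>i q. v i q + v' i q"])
      (simp add: uv uv' sum.distrib[symmetric] algebra_simps)
qed

lemma linear_image_scale:
  assumes "linear_image Z" shows "linear_image (\<lambda>p q. k * Z p q)"
proof -
  obtain u v where uv: "\<And>p q. p < n \<Longrightarrow> q < n \<Longrightarrow> Z p q = (\<Sum>i<n. (u i p + v i q) * moment1 i (int q - int p))"
    using assms(1) unfolding linear_image_def by blast
  show ?thesis
    by (rule linear_imageI[where u = "\<lambda>i p. k * u i p" and v = "\<lambda>i q. k * v i q"])
      (simp add: uv sum_distrib_left algebra_simps)
qed

lemma linear_image_zero: "linear_image (\<lambda>p q. 0)"
  by (rule linear_imageI[where u = "\<lambda>i p. 0" and v = "\<lambda>i q. 0"]) simp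

lemma linear_image_sum:
  assumes "\<And>f. f \<in> F \<Longrightarrow> linear_image (Z f)"
  shows "linear_image (\<lambda>p q. \<Sum>f\<in>F. Z f p q)"
  using assms
  by (induction F rule: infinite_finite_induct) (auto intro: linear_image_zero linear_image_add)

definition \<mu> :: "int \<Rightarrow> complex" where "\<mu> d = (character n d - 1) * \<tau> (- d) / of_nat n"

text \<open>What remains of the diagonal of Z when a matrix in the linear image with the same off-diagonal
entries as Z has been subtracted; this matrix is the one found in linear_image_reduce.\<close>

definition diag_defect :: "(nat \<Rightarrow> nat \<Rightarrow> complex) \<Rightarrow> nat \<Rightarrow> complex" where
  "diag_defect Z p = Z p p - (\<Sum>q\<in>{..<n} - {p}. \<mu> (int q - int p) * Z p q)"

definition diagonal :: "(nat \<Rightarrow> complex) \<Rightarrow> nat \<Rightarrow> nat \<Rightarrow> complex" where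
  "diagonal D p q = (if p = q then D p else 0)"

text \<open>Off the diagonal, row p of the linear image consists of the Fourier transform of i \<mapsto> u i p on the
residues, up to known nonzero factors. Inverting the transform realizes any off-diagonal part by u alone, and
\<mu> records which diagonal this choice produces.\<close>

lemma linear_image_reduce:
  "\<exists>Z'. linear_image Z' \<and> (\<forall>p<n. \<forall>q<n. Z p q = Z' p q + diagonal (diag_defect Z) p q)"
proof -
  \<comment> \<open>Fourier inversion; the factors \<omega>^(r - p) - 1 undo the denominators of the first moments.\<close>
  define u where "u i p = (\<Sum>r\<in>{..<n} - {p}. (character n (int r - int p) - 1) / of_nat n * Z p r * character n (- (int r - int p) * s i))" for i p
  define Z' where "Z' p q = (\<Sum>i<n. (u i p + 0) * moment1 i (int q - int p))" for p q
  have "linear_image Z'"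
    by (rule linear_imageI[where u = u and v = "\<lambda>i q. 0"]) (simp add: Z'_def)
  moreover have "Z p q = Z' p q + diagonal (diag_defect Z) p q" if pq: "p < n" "q < n" for p q
  proof -
    have Z': "Z' p q = (\<Sum>r\<in>{..<n} - {p}. (character n (int r - int p) - 1) / of_nat n * Z p r *
        (\<Sum>i<n. character n (- (int r - int p) * s i) * moment1 i (int q - int p)))"
      unfolding Z'_def u_def sum_distrib_left sum_distrib_right add_0_right
      by (subst sum.swap) (simp add: mult.assoc)
    show ?thesis
    proof (cases "p = q")
      case True
      have "Z' p q = (\<Sum>r\<in>{..<n} - {p}. \<mu> (int r - int p) * Z p r)"
        unfolding Z' by (intro sum.cong refl) (simp add: True moment1_0 \<mu>_def \<tau>_def mult.commute)
      then show ?thesis using True by (simp add: diagonal_def diag_defect_def)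
    next
      case False
      let ?d = "int q - int p"
      have nd: "\<not> int n dvd ?d" using not_dvd_diff[OF pq False] .
      have "(\<Sum>i<n. character n (- (int r - int p) * s i) * moment1 i ?d) = (if r = q then of_nat n / (character n ?d - 1) else 0)"
        if "r < n" for r
      proof -
        have "(\<Sum>i<n. character n (- (int r - int p) * s i) * moment1 i ?d) = (\<Sum>i<n. character n ((int q - int r) * s i)) / (character n ?d - 1)"
          unfolding sum_divide_distrib moment1_off[OF nd]
          by (intro sum.cong refl) (simp add: character_add[symmetric] algebra_simps)
        then show ?thesis using not_dvd_diff[OF that pq(2)] by (auto simp: sum_character_s)
      qed
      then have "Z' p q = (\<Sum>r\<in>{..<n} - {p}. (character n (int r - int p) - 1) / of_nat n * Z p r *
          (if r = q then of_nat n / (character n ?d - 1) else 0))"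
        unfolding Z' by (intro sum.cong refl) simp
      also have "\<dots> = Z p q"
        using pq False n_pos character_ne_1[OF nd]
        by (subst sum.remove[of _ q]) (auto intro!: sum.neutral)
      finally show ?thesis using False by (simp add: diagonal_def)
    qed
  qed
  ultimately show ?thesis by blast
qed

text \<open>A displacement u i p that does not depend on i has no effect off the diagonal and multiplies by \<kappa> on
the diagonal, so for nonzero \<kappa> it repairs the diagonal defect.\<close>

lemma linear_image_all:
  assumes "\<kappa> \<noteq> 0" shows "linear_image Z"
proof -
  obtain Z' where Z': "linear_image Z'" "\<And>p q. p < n \<Longrightarrow> q < n \<Longrightarrow> Z p q = Z' p q + diagonal (diag_defect Z) p q"
    using linear_image_reduce[of Z] by blast
  have const: "(\<Sum>i<n. (k / \<kappa> + 0) * moment1 i d) = (if int n dvd d then k else 0)" for k d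
    using assms by (simp only: add_0_right sum_distrib_left[symmetric] sum_moment1) simp
  have "linear_image (diagonal (diag_defect Z))"
    by (rule linear_imageI[where u = "\<lambda>i p. diag_defect Z p / \<kappa>" and v = "\<lambda>i q. 0"])
      (unfold const, use not_dvd_diff in \<open>auto simp: diagonal_def\<close>)
  from linear_image_add[OF Z'(1) this] show ?thesis by (rule linear_image_cong) (rule Z'(2))
qed

lemma exists_shifted_index: "\<exists>j<n. int n dvd s i - s j - f"
proof -
  have "nat ((s i - f) mod int n) \<in> {..<n}" using n_pos by (simp add: nat_less_iff)
  then have "nat ((s i - f) mod int n) \<in> (\<lambda>j. nat (s j mod int n)) ` {..<n}"
    using bij_betw_imp_surj_on[OF bij_betw_residues[OF n_pos incongruent]] by simp
  then obtain j where j: "j < n" "nat ((s i - f) mod int n) = nat (s j mod int n)" by blast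
  then have "(s i - f) mod int n = s j mod int n" using n_pos by (simp add: nat_eq_iff)
  then have "int n dvd (s i - f) - s j" by (simp add: mod_eq_dvd_iff[symmetric])
  then show ?thesis using j(1) by (auto simp: algebra_simps)
qed

text \<open>Choose j such that s_j is congruent to s_0 - f and let only u 0 p = \<omega>^(f p) and
v j q = - \<omega>^(f q) be nonzero. Off the diagonal the two contributions cancel, because
\<omega>^(f p + (q - p) s_0) and \<omega>^(f q + (q - p) s_j) agree. On the diagonal they leave
\<omega>^(f p) (s_0 - s_j), with a nonzero factor.\<close>

lemma linear_image_character:
  assumes f: "\<not> int n dvd f" shows "linear_image (diagonal (\<lambda>p. character n (f * int p)))"
proof -
  obtain j where j: "j < n" "int n dvd s 0 - s j - f" using exists_shifted_index by blast
  have "s 0 \<noteq> s j" using j f by auto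
  then have ne: "(of_int (s 0) - of_int (s j) :: complex) \<noteq> 0" by simp
  let ?u = "\<lambda>i p. if i = 0 then character n (f * int p) else 0"
  let ?v = "\<lambda>i q. if i = j then - character n (f * int q) else 0"
  have eq: "(\<Sum>i<n. (?u i p + ?v i q) * moment1 i d) = character n (f * int p) * moment1 0 d - character n (f * int q) * moment1 j d" for p q d
  proof -
    have "(\<Sum>i<n. (?u i p + ?v i q) * moment1 i d) = (\<Sum>i<n. ?u i p * moment1 i d) + (\<Sum>i<n. ?v i q * moment1 i d)"
      by (simp add: sum.distrib[symmetric] ring_distribs)
    also have "(\<Sum>i<n. ?u i p * moment1 i d) = character n (f * int p) * moment1 0 d"
      using n_pos by (subst sum.remove[of _ 0]) (auto intro!: sum.neutral)
    also have "(\<Sum>i<n. ?v i q * moment1 i d) = - character n (f * int q) * moment1 j d"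
      using j(1) by (subst sum.remove[of _ j]) (auto intro!: sum.neutral)
    finally show ?thesis by simp
  qed
  have "linear_image (\<lambda>p q. (of_int (s 0) - of_int (s j)) * diagonal (\<lambda>p. character n (f * int p)) p q)"
  proof (rule linear_imageI[where u = ?u and v = ?v], unfold eq)
    fix p q assume pq: "p < n" "q < n"
    show "(of_int (s 0) - of_int (s j)) * diagonal (\<lambda>p. character n (f * int p)) p q
      = character n (f * int p) * moment1 0 (int q - int p) - character n (f * int q) * moment1 j (int q - int p)"
    proof (cases "p = q")
      case True then show ?thesis by (simp add: diagonal_def moment1_0 \<sigma>_def algebra_simps)
    next
      case False
      have nd: "\<not> int n dvd int q - int p" using not_dvd_diff[OF pq False] .
      have "character n (f * int q + (int q - int p) * s j) = character n (f * int p + (int q - int p) * s 0)"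
      proof (rule character_cong[OF n_pos])
        have "f * int q + (int q - int p) * s j - (f * int p + (int q - int p) * s 0) = - (int q - int p) * (s 0 - s j - f)"
          by (simp add: algebra_simps)
        then show "int n dvd f * int q + (int q - int p) * s j - (f * int p + (int q - int p) * s 0)"
          using j(2) by simp
      qed
      then show ?thesis using False by (simp add: moment1_off[OF nd] diagonal_def character_add)
    qed
  qed
  from linear_image_scale[OF this, of "1 / (of_int (s 0) - of_int (s j))"]
  show ?thesis by (rule linear_image_cong) (use ne in simp)
qed

text \<open>A diagonal of sum zero is a combination of the nontrivial characters.\<close>

lemma linear_image_sum_zero_diagonal:
  assumes D: "(\<Sum>p<n. D p) = 0" shows "linear_image (diagonal D)"
proof -
  define \<phi> where "\<phi> f = (\<Sum>q<n. D q * character n (- int f * int q)) / of_nat n" for f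
  have \<phi>0: "\<phi> 0 = 0" using D by (simp add: \<phi>_def)
  have inv: "D p = (\<Sum>f<n. \<phi> f * character n (int f * int p))" if "p < n" for p
  proof -
    have "(\<Sum>f<n. \<phi> f * character n (int f * int p)) = (\<Sum>f<n. \<Sum>q<n. D q / of_nat n * character n ((int p - int q) * int f))"
      unfolding \<phi>_def sum_divide_distrib sum_distrib_right
      by (intro sum.cong refl) (simp add: character_add[symmetric] algebra_simps)
    also have "\<dots> = (\<Sum>q<n. D q / of_nat n * (\<Sum>f<n. character n ((int p - int q) * int f)))"
      by (subst sum.swap) (simp add: sum_distrib_left)
    also have "\<dots> = (\<Sum>q<n. if q = p then D q else 0)"
      unfolding sum_character[OF n_pos]
      using not_dvd_diff[OF _ that] n_pos by (intro sum.cong refl) auto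
    finally show ?thesis using that by simp
  qed
  have "linear_image (\<lambda>p q. \<Sum>f<n. \<phi> f * diagonal (\<lambda>p. character n (int f * int p)) p q)"
  proof (rule linear_image_sum)
    fix f assume "f \<in> {..<n}"
    then have f: "f < n" by simp
    show "linear_image (\<lambda>p q. \<phi> f * diagonal (\<lambda>p. character n (int f * int p)) p q)"
    proof (cases "f = 0")
      case True then show ?thesis using \<phi>0 linear_image_zero by simp
    next
      case False
      then have "\<not> int n dvd int f" using not_dvd_diff[OF n_pos f] by simp
      then show ?thesis by (intro linear_image_scale linear_image_character)
    qed
  qed
  then show ?thesis
    by (rule linear_image_cong) (use inv in \<open>auto simp: diagonal_def\<close>)
qed

text \<open>For \<kappa> = 0 the kernel of this functional is the linear image.\<close>

definition \<Lambda> :: "(nat \<Rightarrow> nat \<Rightarrow> complex) \<Rightarrow> complex" where "\<Lambda> Z = (\<Sum>p<n. diag_defect Z p)"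

lemma linear_image_kernel:
  assumes "\<Lambda> Z = 0" shows "linear_image Z"
proof -
  obtain Z' where Z': "linear_image Z'" "\<And>p q. p < n \<Longrightarrow> q < n \<Longrightarrow> Z p q = Z' p q + diagonal (diag_defect Z) p q"
    using linear_image_reduce[of Z] by blast
  have "linear_image (diagonal (diag_defect Z))"
    using assms unfolding \<Lambda>_def by (rule linear_image_sum_zero_diagonal)
  from linear_image_add[OF Z'(1) this] show ?thesis by (rule linear_image_cong) (rule Z'(2))
qed

lemma \<Lambda>_diff: "\<Lambda> (\<lambda>p q. Z p q - Z' p q) = \<Lambda> Z - \<Lambda> Z'"
  by (simp add: \<Lambda>_def diag_defect_def sum_subtractf sum.distrib algebra_simps)

lemma \<Lambda>_scale: "\<Lambda> (\<lambda>p q. k * Z p q) = k * \<Lambda> Z"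
  by (simp add: \<Lambda>_def diag_defect_def sum_distrib_left algebra_simps)

lemma \<Lambda>_single:
  assumes ab: "a < n" "b < n" "a \<noteq> b"
    and Z: "\<And>p q. p < n \<Longrightarrow> q < n \<Longrightarrow> Z p q = (if p = a \<and> q = b then c else 0)"
  shows "\<Lambda> Z = - \<mu> (int b - int a) * c"
proof -
  have dd: "diag_defect Z p = (if p = a then - \<mu> (int b - int a) * c else 0)" if "p < n" for p
  proof -
    have "(\<Sum>q\<in>{..<n} - {p}. \<mu> (int q - int p) * Z p q) = (\<Sum>q\<in>{..<n} - {p}. if q = b then (if p = a then \<mu> (int b - int a) * c else 0) else 0)"
      by (intro sum.cong refl) (use Z that in auto)
    also have "\<dots> = (if p = a then \<mu> (int b - int a) * c else 0)" using ab by (auto simp: sum.delta)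
    finally show ?thesis using Z[OF that that] ab that by (auto simp: diag_defect_def)
  qed
  have "\<Lambda> Z = (\<Sum>p<n. if p = a then - \<mu> (int b - int a) * c else 0)"
    unfolding \<Lambda>_def by (intro sum.cong refl) (simp add: dd)
  then show ?thesis using ab by simp
qed


text \<open>The coefficients of the sum of T_i T_j over all i before j in the list, for T_i with the first
moments of type s_i as circulant coefficients.\<close>

primrec cross :: "nat list \<Rightarrow> int \<Rightarrow> int \<Rightarrow> complex" where
  "cross [] d d' = 0"
| "cross (i # js) d d' = cross js d d' + moment1 i d * (\<Sum>j\<leftarrow>js. moment1 j d')"

lemma cross_symmetrized:
  "cross js d d' + cross js d' d + (\<Sum>j\<leftarrow>js. moment1 j d * moment1 j d') = (\<Sum>j\<leftarrow>js. moment1 j d) * (\<Sum>j\<leftarrow>js. moment1 j d')"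
  by (induction js) (simp_all add: algebra_simps)

lemma cross_periodic:
  assumes "int n dvd x - x'" "int n dvd y - y'" shows "cross js x y = cross js x' y'"
  using moment1_periodic[OF assms(1)] moment1_periodic[OF assms(2)] by (induction js) simp_all

lemma sum_list_upt: "(\<Sum>j\<leftarrow>[0..<n]. f j) = (\<Sum>j<n. f j :: complex)"
  by (simp add: sum_list_distinct_conv_sum_set atLeast0LessThan)

lemma sum_reflect:
  assumes "\<And>x y. int n dvd x - y \<Longrightarrow> f x = (f y :: complex)"
  shows "(\<Sum>r<n. f (c - int r)) = (\<Sum>r<n. f (int r))"
proof (rule sum_complete_residues[OF n_pos assms])
  fix i j assume ij: "i < n" "j < n" "int n dvd c - int i - (c - int j)"
  have "c - int i - (c - int j) = int j - int i" by simp
  then show "i = j" using ij not_dvd_diff[OF ij(1,2)] by metis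
qed

text \<open>In terms of circulants: squaring the circulant with eigenvalues e, the exponents of type s_i, squares
the eigenvalues.\<close>

lemma moment1_convolution: "(\<Sum>r<n. moment1 i (int r - a) * moment1 i (b - int r)) = moment2 i (b - a)"
proof -
  define w where "w k = (of_int (s i) + of_nat k :: complex)" for k
  define \<nu> where "\<nu> k = s i + int k" for k
  have "(\<Sum>r<n. moment1 i (int r - a) * moment1 i (b - int r))
    = (\<Sum>r<n. \<Sum>k<n. \<Sum>l<n. w k * w l * character n (b * \<nu> l - a * \<nu> k) * character n ((int k - int l) * int r)) / (of_nat n * of_nat n)"
    unfolding moment1_def times_divide_times_eq sum_divide_distrib[symmetric] sum_product
    by (intro arg_cong[where f = "\<lambda>x. x / (of_nat n * of_nat n)"] sum.cong refl)
      (simp add: w_def \<nu>_def mult_ac character_add[symmetric], simp add: algebra_simps)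
  also have "(\<Sum>r<n. \<Sum>k<n. \<Sum>l<n. w k * w l * character n (b * \<nu> l - a * \<nu> k) * character n ((int k - int l) * int r))
    = (\<Sum>k<n. \<Sum>l<n. w k * w l * character n (b * \<nu> l - a * \<nu> k) * (\<Sum>r<n. character n ((int k - int l) * int r)))"
    unfolding sum_distrib_left by (rule trans[OF sum.swap], rule sum.cong[OF refl], rule sum.swap)
  also have "\<dots> = (\<Sum>k<n. \<Sum>l<n. if l = k then (w k)\<^sup>2 * character n ((b - a) * \<nu> k) * of_nat n else 0)"
    unfolding sum_character[OF n_pos] using not_dvd_diff
    by (intro sum.cong refl) (auto simp: power2_eq_square left_diff_distrib)
  also have "\<dots> = (\<Sum>k<n. (w k)\<^sup>2 * character n ((b - a) * \<nu> k)) * of_nat n"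
    unfolding sum_distrib_right by (intro sum.cong refl) simp
  finally show ?thesis using n_pos unfolding moment2_def w_def \<nu>_def by simp
qed

text \<open>Circulants commute, so twice the sum of the products over i before j is the square of the sum minus
the sum of the squares. For \<kappa> = 0 the sum is the zero matrix.\<close>

lemma sum_cross:
  assumes "\<kappa> = 0"
  shows "2 * (\<Sum>r<n. cross [0..<n] (int r - a) (b - int r)) = - (\<Sum>i<n. moment2 i (b - a))"
proof -
  let ?X = "\<Sum>r<n. cross [0..<n] (int r - a) (b - int r)"
  have "(\<Sum>r<n. cross [0..<n] (b - int r) (int r - a)) = (\<Sum>r<n. cross [0..<n] ((a + b - int r) - a) (b - (a + b - int r)))"
    by (simp add: algebra_simps)
  also have "\<dots> = ?X"
    by (rule sum_reflect[where f = "\<lambda>x. cross [0..<n] (x - a) (b - x)"])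
      (rule cross_periodic, simp_all add: dvd_diff_commute)
  finally have swap: "(\<Sum>r<n. cross [0..<n] (b - int r) (int r - a)) = ?X" .
  have "(\<Sum>r<n. cross [0..<n] (int r - a) (b - int r) + cross [0..<n] (b - int r) (int r - a)
      + (\<Sum>i<n. moment1 i (int r - a) * moment1 i (b - int r))) = (\<Sum>r<n. 0)"
    using cross_symmetrized[of "[0..<n]"] assms by (intro sum.cong refl) (simp add: sum_list_upt sum_moment1)
  moreover have "(\<Sum>r<n. \<Sum>i<n. moment1 i (int r - a) * moment1 i (b - int r)) = (\<Sum>i<n. moment2 i (b - a))"
    by (rule trans[OF sum.swap]) (simp only: moment1_convolution)
  ultimately have "?X + ?X + (\<Sum>i<n. moment2 i (b - a)) = 0"
    unfolding sum.distrib swap by simp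
  then show ?thesis by (simp add: eq_neg_iff_add_eq_0)
qed

text \<open>The second-order coefficient of the product, up to the factor n^n, when all nodes move
logarithmically in such a way that y_p x_q moves at the rate \<theta> p q, the same for every i.\<close>

definition quadratic :: "(nat \<Rightarrow> nat \<Rightarrow> complex) \<Rightarrow> nat \<Rightarrow> nat \<Rightarrow> complex" where
  "quadratic \<theta> p q = (\<theta> p q)\<^sup>2 / 2 * (\<Sum>i<n. moment2 i (int q - int p)) +
     (\<Sum>r<n. \<theta> p r * \<theta> r q * cross [0..<n] (int r - int p) (int q - int r))"

text \<open>For the indicators of p = a and q = b the mixed terms survive only at the entry (a, b). There
the second moments contribute their full sum and the products with i before j minus half of it.\<close>

lemma quadratic_polarized:
  assumes ab: "a < n" "b < n" "a \<noteq> b" and \<kappa>: "\<kappa> = 0"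
  shows "quadratic (\<lambda>p q. of_bool (p = a) + of_bool (q = b)) p q - quadratic (\<lambda>p q. of_bool (p = a)) p q
     - quadratic (\<lambda>p q. of_bool (q = b)) p q
     = (if p = a \<and> q = b then \<tau> (int b - int a) / (character n (int b - int a) - 1) else 0)"
proof -
  let ?S = "\<Sum>i<n. moment2 i (int q - int p)" and ?K = "\<lambda>r. cross [0..<n] (int r - int p) (int q - int r)"
  have pt: "(of_bool (p = a) + of_bool (r = b)) * (of_bool (r = a) + of_bool (q = b)) * ?K r
      - of_bool (p = a) * of_bool (r = a) * ?K r - of_bool (r = b) * of_bool (q = b) * ?K r
      = (if p = a \<and> q = b then ?K r else 0)" for r
    using ab(3) by auto
  have "quadratic (\<lambda>p q. of_bool (p = a) + of_bool (q = b)) p q - quadratic (\<lambda>p q. of_bool (p = a)) p q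
     - quadratic (\<lambda>p q. of_bool (q = b)) p q
     = (if p = a \<and> q = b then ?S else 0) + (\<Sum>r<n. if p = a \<and> q = b then ?K r else 0)"
    unfolding quadratic_def pt[symmetric] sum_subtractf
    by (auto simp: power2_eq_square)
  also have "\<dots> = (if p = a \<and> q = b then ?S + (\<Sum>r<n. ?K r) else 0)"
  proof (cases "p = a \<and> q = b")
    case False
    then have "(p = a \<and> q = b) = False" by simp
    then show ?thesis by (simp only: if_False sum.neutral_const add_0)
  qed simp
  also have "\<dots> = (if p = a \<and> q = b then \<tau> (int b - int a) / (character n (int b - int a) - 1) else 0)"
  proof (cases "p = a \<and> q = b")
    case True
    have nd: "\<not> int n dvd int b - int a" using not_dvd_diff[OF ab] .
    have "2 * (?S + (\<Sum>r<n. ?K r)) = ?S" using sum_cross[OF \<kappa>, of "int p" "int q"] by simp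
    also have "\<dots> = 2 * (\<tau> (int b - int a) / (character n (int b - int a) - 1))"
      using True sum_moment2_off[OF nd] by simp
    finally have "?S + (\<Sum>r<n. ?K r) = \<tau> (int b - int a) / (character n (int b - int a) - 1)"
      by (subst (asm) mult_cancel_left) simp
    then show ?thesis using True by simp
  qed auto
  finally show ?thesis .
qed

lemma cnj_\<tau>: "cnj (\<tau> d) = \<tau> (- d)"
  by (simp add: \<tau>_def cnj_character \<sigma>_def)

text \<open>Otherwise Fourier inversion would make \<sigma> constant, and hence s_0 = s_1.\<close>

lemma exists_\<tau>_nonzero:
  assumes "2 \<le> n" shows "\<exists>d. 0 < d \<and> d < n \<and> \<tau> (int d) \<noteq> 0"
proof (rule ccontr)
  assume "\<not> ?thesis"
  then have zero: "\<tau> (int d) = 0" if "0 < d" "d < n" for d using that by blast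
  have "of_nat n * \<sigma> i = \<tau> 0" if "i < n" for i
  proof -
    have "(\<Sum>d<n. \<tau> (int d) * character n (- int d * s i)) = (\<Sum>j<n. \<sigma> j * (\<Sum>d<n. character n ((s j - s i) * int d)))"
      unfolding \<tau>_def sum_distrib_left sum_distrib_right
      by (subst sum.swap, intro sum.cong refl) (simp add: mult.assoc character_add[symmetric], simp add: algebra_simps)
    also have "\<dots> = (\<Sum>j<n. if j = i then \<sigma> j * of_nat n else 0)"
      unfolding sum_character[OF n_pos] using incongruent that by (intro sum.cong refl) auto
    also have "\<dots> = of_nat n * \<sigma> i" using that by simp
    finally have "of_nat n * \<sigma> i = (\<Sum>d<n. \<tau> (int d) * character n (- int d * s i))" by simp
    also have "\<dots> = \<tau> (int 0) * character n (- int 0 * s i)"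
      using n_pos zero by (subst sum.remove[of _ 0]) (auto intro!: sum.neutral)
    finally show ?thesis by simp
  qed
  from this[of 0] this[of 1] have "of_nat n * \<sigma> 0 = of_nat n * \<sigma> 1" using assms by simp
  then have "s 0 = s 1" using n_pos by (simp add: \<sigma>_def)
  then show False using incongruent[of 0 1] assms by simp
qed

text \<open>The values of \<Lambda> on the quadratic term at the sum of the two indicators and at each of them cannot
all vanish, since polarization yields - |\<tau> d|^2 / n. This number is nonzero because \<tau> (- d)
is the complex conjugate of \<tau> d, the values \<sigma> i being real.\<close>

lemma exists_quadratic_transversal:
  assumes n: "2 \<le> n" and \<kappa>: "\<kappa> = 0"
  shows "\<exists>\<eta> \<xi>. \<Lambda> (quadratic (\<lambda>p q. \<eta> p + \<xi> q)) \<noteq> 0"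
proof -
  obtain d where d: "0 < d" "d < n" "\<tau> (int d) \<noteq> 0" using exists_\<tau>_nonzero[OF n] by blast
  have d0: "0 < n" "d < n" "0 \<noteq> d" using d by auto
  have nd: "character n (int d) - 1 \<noteq> 0" using character_ne_1 not_dvd_diff[OF d0] by simp
  let ?\<theta> = "\<lambda>\<eta> \<xi> p q. \<eta> p + \<xi> q :: complex"
  let ?a = "\<lambda>p. of_bool (p = 0)" and ?b = "\<lambda>q. of_bool (q = d)" and ?z = "\<lambda>p. 0"
  let ?Q = "\<lambda>\<eta> \<xi>. \<Lambda> (quadratic (\<lambda>p q. \<eta> p + \<xi> q))"
  have "?Q ?a ?b - ?Q ?a ?z - ?Q ?z ?b = \<Lambda> (\<lambda>p q. quadratic (\<lambda>p q. of_bool (p = 0) + of_bool (q = d)) p q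
      - quadratic (\<lambda>p q. of_bool (p = 0)) p q - quadratic (\<lambda>p q. of_bool (q = d)) p q)"
    unfolding \<Lambda>_diff by simp
  also have "\<dots> = - \<mu> (int d - int 0) * (\<tau> (int d - int 0) / (character n (int d - int 0) - 1))"
    by (rule \<Lambda>_single[OF d0]) (rule quadratic_polarized[OF d0 \<kappa>])
  also have "\<dots> = - (cnj (\<tau> (int d)) * \<tau> (int d)) / of_nat n"
    using nd by (simp add: \<mu>_def cnj_\<tau>)
  also have "\<dots> \<noteq> 0" using d n_pos by simp
  finally have "?Q ?a ?b - ?Q ?a ?z - ?Q ?z ?b \<noteq> 0" .
  then have "?Q ?a ?b \<noteq> 0 \<or> ?Q ?a ?z \<noteq> 0 \<or> ?Q ?z ?b \<noteq> 0" by force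
  then show ?thesis
    by (elim disjE)
      (rule exI[of _ ?a], rule exI[of _ ?b], assumption,
        rule exI[of _ ?a], rule exI[of _ ?z], assumption,
        rule exI[of _ ?z], rule exI[of _ ?b], assumption)
qed

lemma node_product:
  "(character n (- int p) * exp A) powi j * (character n (int q) * exp B) powi j
    = character n ((int q - int p) * j) * exp (of_int j * (A + B))"
proof -
  have "(character n a * exp z) powi j = character n (a * j) * exp (of_int j * z)" for a z
    by (simp add: power_int_mult_distrib character_powi exp_power_int)
  then have "(character n (- int p) * exp A) powi j * (character n (int q) * exp B) powi j
      = (character n (- int p * j) * character n (int q * j)) * (exp (of_int j * A) * exp (of_int j * B))"
    by (simp only: mult_ac)
  then show ?thesis unfolding character_add[symmetric] exp_add[symmetric] by (simp add: algebra_simps)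
qed

text \<open>The rates \<eta>, \<xi> are of first order in \<epsilon> and common to all factors, while u, v are of second order
and individual. Hence u, v enter the coefficient of \<epsilon>^2 linearly and \<eta>, \<xi> enter it quadratically.
Exponential factors are used because a power of a node then has its exponent as logarithmic rate.\<close>

lemma vand_prod_expansion:
  fixes u v :: "nat \<Rightarrow> nat \<Rightarrow> complex" and \<eta> \<xi> :: "nat \<Rightarrow> complex"
  defines "y \<equiv> \<lambda>\<epsilon> i p. character n (- int p) * exp (\<epsilon> * \<eta> p + \<epsilon>\<^sup>2 * u i p)"
    and "x \<equiv> \<lambda>\<epsilon> i q. character n (int q) * exp (\<epsilon> * \<xi> q + \<epsilon>\<^sup>2 * v i q)"
  assumes pq: "p < n" "q < n"
  shows "expansion2 (\<lambda>\<epsilon>. vand_prod n s (y \<epsilon>) (x \<epsilon>) $$ (p, q)) (if p = q then of_nat n ^ n else 0)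
    (of_nat n ^ n * (\<Sum>i<n. (\<eta> p + \<xi> q) * moment1 i (int q - int p)))
    (of_nat n ^ n * ((\<Sum>i<n. (u i p + v i q) * moment1 i (int q - int p)) + quadratic (\<lambda>p q. \<eta> p + \<xi> q) p q))"
proof -
  define \<theta> where "\<theta> p q = \<eta> p + \<xi> q" for p q
  define G where "G i \<epsilon> = transpose_mat (gen_vandermonde n (s i) (y \<epsilon> i)) * gen_vandermonde n (s i) (x \<epsilon> i)" for i \<epsilon>
  define T where "T i p q = \<theta> p q * moment1 i (int q - int p)" for i p q
  define U where "U i p q = (u i p + v i q) * moment1 i (int q - int p) + (\<theta> p q)\<^sup>2 / 2 * moment2 i (int q - int p)" for i p q
  define W where "W js p q = (\<Sum>r<n. \<theta> p r * \<theta> r q * cross js (int r - int p) (int q - int r))" for js p q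
  have G_carrier: "G i \<epsilon> \<in> carrier_mat n n" for i \<epsilon>
    unfolding G_def by (rule mult_carrier_mat[of _ n n]) (simp_all add: gen_vandermonde_carrier)
  have G_entry: "G i \<epsilon> $$ (p, q) = (\<Sum>k<n. character n ((int q - int p) * (s i + int k)) *
      exp ((of_int (s i) + of_nat k) * (\<epsilon> * \<theta> p q + \<epsilon>\<^sup>2 * (u i p + v i q))))"
    if "p < n" "q < n" for i \<epsilon> p q
  proof -
    have "G i \<epsilon> $$ (p, q) = (\<Sum>k<n. y \<epsilon> i p powi (s i + int k) * x \<epsilon> i q powi (s i + int k))"
      unfolding G_def
      by (subst mult_mat_entry[of _ n]) (use that in \<open>simp_all add: gen_vandermonde_def\<close>)
    also have "\<dots> = (\<Sum>k<n. character n ((int q - int p) * (s i + int k)) *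
      exp ((of_int (s i) + of_nat k) * (\<epsilon> * \<theta> p q + \<epsilon>\<^sup>2 * (u i p + v i q))))"
      unfolding y_def x_def node_product \<theta>_def by (intro sum.cong refl) (simp add: algebra_simps)
    finally show ?thesis .
  qed
  have G: "expansion2 (\<lambda>\<epsilon>. G i \<epsilon> $$ (p, q)) (if p = q then of_nat n else 0) (of_nat n * T i p q) (of_nat n * U i p q)"
    if pq: "p < n" "q < n" for i p q
    unfolding G_entry[OF pq]
  proof (rule expansion2_cong[OF expansion2_sum[OF expansion2_cmult[OF expansion2_exp]] refl])
    let ?d = "int q - int p" and ?w = "\<lambda>k. of_int (s i) + of_nat k :: complex"
    have "(\<Sum>k<n. character n (?d * (s i + int k)) * 1) = character n (?d * s i) * (\<Sum>k<n. character n (?d * int k))"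
      by (simp add: character_add ring_distribs sum_distrib_left)
    then show "(\<Sum>k<n. character n (?d * (s i + int k)) * 1) = (if p = q then of_nat n else 0)"
      using not_dvd_diff[OF pq] by (simp add: sum_character[OF n_pos])
    have n1: "of_nat n * moment1 i ?d = (\<Sum>k<n. ?w k * character n (?d * (s i + int k)))"
      using n_pos by (simp add: moment1_def)
    have n2: "of_nat n * moment2 i ?d = (\<Sum>k<n. (?w k)\<^sup>2 * character n (?d * (s i + int k)))"
      using n_pos by (simp add: moment2_def)
    have "of_nat n * T i p q = \<theta> p q * (of_nat n * moment1 i ?d)" by (simp add: T_def)
    then show "(\<Sum>k<n. character n (?d * (s i + int k)) * (?w k * \<theta> p q)) = of_nat n * T i p q"
      unfolding n1 sum_distrib_left by (simp add: mult_ac)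
    have "of_nat n * U i p q = (u i p + v i q) * (of_nat n * moment1 i ?d) + (\<theta> p q)\<^sup>2 / 2 * (of_nat n * moment2 i ?d)"
      by (simp add: U_def algebra_simps)
    note U_eq = this
    have distribute: "r * (w * A + (w * B)\<^sup>2 / 2) = A * (w * r) + B\<^sup>2 / 2 * (w\<^sup>2 * r)" for r w A B :: complex
      by (simp add: power_mult_distrib algebra_simps)
    show "(\<Sum>k<n. character n (?d * (s i + int k)) * (?w k * (u i p + v i q) + (?w k * \<theta> p q)\<^sup>2 / 2)) = of_nat n * U i p q"
      unfolding U_eq n1 n2 sum_distrib_left sum.distrib[symmetric]
      by (rule sum.cong[OF refl]) (rule distribute)
  qed
  have W: "W [] p q = 0" "W (i # js) p q = W js p q + (\<Sum>r<n. T i p r * (\<Sum>j\<leftarrow>js. T j r q))" for i js p q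
    unfolding W_def T_def sum_list_const_mult sum.distrib[symmetric]
    by (simp_all add: algebra_simps)
  from foldr_mult_expansion2[of G n "of_nat n" T U W p q "[0..<n]", OF G_carrier G W pq]
  show ?thesis
  proof (rule expansion2_cong)
    show "(\<lambda>\<epsilon>. foldr (*) (map (\<lambda>i. G i \<epsilon>) [0..<n]) (1\<^sub>m n) $$ (p, q)) = (\<lambda>\<epsilon>. vand_prod n s (y \<epsilon>) (x \<epsilon>) $$ (p, q))"
      by (simp add: vand_prod_def alt_prod_def G_def)
    show "of_nat n ^ length [0..<n] * ((\<Sum>j\<leftarrow>[0..<n]. U j p q) + W [0..<n] p q) =
        of_nat n ^ n * ((\<Sum>i<n. (u i p + v i q) * moment1 i (int q - int p)) + quadratic (\<lambda>p q. \<eta> p + \<xi> q) p q)"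
      unfolding sum_list_upt U_def W_def quadratic_def \<theta>_def sum.distrib sum_distrib_left[symmetric]
      by (simp add: algebra_simps)
  qed (simp_all add: sum_list_upt T_def \<theta>_def)
qed

text \<open>For nonzero \<kappa> the linear term reaches Z by itself. For \<kappa> = 0 a multiple of the quadratic term is
used to match \<Lambda> Z, which requires scaling \<eta>, \<xi> by a complex square root; the difference then lies in the
linear image, and the first-order term vanishes because the first moments sum to zero.\<close>

lemma vand_image_curve:
  assumes "\<kappa> \<noteq> 0 \<or> 2 \<le> n"
  shows "\<exists>g. (\<forall>\<^sub>F \<epsilon> in at 0. g \<epsilon> \<in> vand_image n s) \<and>
     (\<forall>p<n. \<forall>q<n. ((\<lambda>\<epsilon>. (g \<epsilon> $$ (p, q) - (if p = q then of_nat n ^ n else 0)) / \<epsilon>\<^sup>2) \<longlongrightarrow> Z p q) (at (0 :: complex)))"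
proof -
  let ?N = "of_nat n ^ n :: complex"
  have N: "?N \<noteq> 0" using n_pos by simp
  have "\<exists>\<eta> \<xi> u v. (\<forall>p<n. \<forall>q<n. (\<Sum>i<n. (\<eta> p + \<xi> q) * moment1 i (int q - int p)) = 0 \<and>
     Z p q = ?N * ((\<Sum>i<n. (u i p + v i q) * moment1 i (int q - int p)) + quadratic (\<lambda>p q. \<eta> p + \<xi> q) p q))"
  proof (cases "\<kappa> = 0")
    case False
    obtain u v where uv: "\<And>p q. p < n \<Longrightarrow> q < n \<Longrightarrow> Z p q / ?N = (\<Sum>i<n. (u i p + v i q) * moment1 i (int q - int p))"
      using linear_image_all[OF False, of "\<lambda>p q. Z p q / ?N"] unfolding linear_image_def by blast
    show ?thesis
      by (rule exI[of _ "\<lambda>p. 0"], rule exI[of _ "\<lambda>p. 0"], rule exI[of _ u], rule exI[of _ v])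
        (use N in \<open>simp add: uv[symmetric] quadratic_def\<close>)
  next
    case True
    obtain \<eta> \<xi> where Q: "\<Lambda> (quadratic (\<lambda>p q. \<eta> p + \<xi> q)) \<noteq> 0"
      using exists_quadratic_transversal True assms by blast
    define t where "t = \<Lambda> (\<lambda>p q. Z p q / ?N) / \<Lambda> (quadratic (\<lambda>p q. \<eta> p + \<xi> q))"
    define l where "l = csqrt t"
    have quad: "quadratic (\<lambda>p q. l * \<eta> p + l * \<xi> q) p q = t * quadratic (\<lambda>p q. \<eta> p + \<xi> q) p q" for p q
    proof -
      have "l * l = t" using power2_csqrt[of t] by (simp add: l_def power2_eq_square)
      then have *: "(l * z) * (l * z') = t * (z * z')" for z z' by (metis mult.assoc mult.left_commute)
      have "(l * \<eta> p + l * \<xi> q)\<^sup>2 = t * (\<eta> p + \<xi> q)\<^sup>2"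
        unfolding power2_eq_square distrib_left[symmetric] * ..
      moreover have "(\<Sum>r<n. (l * \<eta> p + l * \<xi> r) * (l * \<eta> r + l * \<xi> q) * f r)
          = t * (\<Sum>r<n. (\<eta> p + \<xi> r) * (\<eta> r + \<xi> q) * f r)" for f
        unfolding distrib_left[symmetric] * sum_distrib_left by (simp add: mult.assoc)
      ultimately show ?thesis unfolding quadratic_def by (simp only:) (simp add: distrib_left)
    qed
    have "\<Lambda> (\<lambda>p q. Z p q / ?N - t * quadratic (\<lambda>p q. \<eta> p + \<xi> q) p q) = 0"
      unfolding \<Lambda>_diff \<Lambda>_scale t_def using Q by simp
    from linear_image_kernel[OF this]
    obtain u v where uv: "\<And>p q. p < n \<Longrightarrow> q < n \<Longrightarrow> Z p q / ?N - t * quadratic (\<lambda>p q. \<eta> p + \<xi> q) p q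
        = (\<Sum>i<n. (u i p + v i q) * moment1 i (int q - int p))"
      unfolding linear_image_def by blast
    have first: "(\<Sum>i<n. k * moment1 i d) = 0" for k d
      by (simp only: sum_distrib_left[symmetric] sum_moment1 True) simp
    show ?thesis
      by (rule exI[of _ "\<lambda>p. l * \<eta> p"], rule exI[of _ "\<lambda>p. l * \<xi> p"], rule exI[of _ u], rule exI[of _ v])
        (use N in \<open>simp add: uv[symmetric] quad first\<close>)
  qed
  then obtain \<eta> \<xi> u v where first: "\<And>p q. p < n \<Longrightarrow> q < n \<Longrightarrow> (\<Sum>i<n. (\<eta> p + \<xi> q) * moment1 i (int q - int p)) = 0"
    and second: "\<And>p q. p < n \<Longrightarrow> q < n \<Longrightarrow> Z p q = ?N * ((\<Sum>i<n. (u i p + v i q) * moment1 i (int q - int p)) + quadratic (\<lambda>p q. \<eta> p + \<xi> q) p q)"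
    by blast
  define y where "y \<epsilon> i p = character n (- int p) * exp (\<epsilon> * \<eta> p + \<epsilon>\<^sup>2 * u i p)" for \<epsilon> i p
  define x where "x \<epsilon> i q = character n (int q) * exp (\<epsilon> * \<xi> q + \<epsilon>\<^sup>2 * v i q)" for \<epsilon> i q
  have "vand_prod n s (y \<epsilon>) (x \<epsilon>) \<in> vand_image n s" for \<epsilon>
    unfolding vand_image_def by (rule CollectI, rule exI[of _ "y \<epsilon>"], rule exI[of _ "x \<epsilon>"]) (simp add: y_def x_def)
  moreover have "((\<lambda>\<epsilon>. (vand_prod n s (y \<epsilon>) (x \<epsilon>) $$ (p, q) - (if p = q then ?N else 0)) / \<epsilon>\<^sup>2) \<longlongrightarrow> Z p q) (at 0)"
    if "p < n" "q < n" for p q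
    using vand_prod_expansion[OF that, of \<eta> u \<xi> v] first[OF that] second[OF that]
    unfolding expansion2_def y_def[abs_def] x_def[abs_def] by simp
  ultimately show ?thesis by (intro exI[of _ "\<lambda>\<epsilon>. vand_prod n s (y \<epsilon>) (x \<epsilon>)"]) simp
qed

end

section \<open>The decomposition\<close>

theorem theorem6p7:
  fixes n :: nat and s :: "nat \<Rightarrow> int"
  assumes "n \<ge> 1"
    and "\<And>i j. i < n \<Longrightarrow> j < n \<Longrightarrow> i \<noteq> j \<Longrightarrow> \<not> [s i = s j] (mod int n)"
    and "(\<Sum>j<n. s j) \<noteq> 0"
  shows "(\<forall>M \<in> carrier_mat n n. invertible_mat M \<longrightarrow>
      (\<exists>A A' B B'.
        (\<forall>i<n. A i \<in> Vand n (s i) \<and> A' i \<in> Vand n (s i) \<and>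
               B i \<in> VandT n (s i) \<and> B' i \<in> VandT n (s i)) \<and>
        M = alt_prod n B A * alt_prod n B' A'))
    \<and> (\<forall>M \<in> carrier_mat n n.
      (\<exists>A A' C C' B B' D D' E.
        (\<forall>i<n. A i \<in> Vand n (s i) \<and> A' i \<in> Vand n (s i) \<and>
               C i \<in> Vand n (s i) \<and> C' i \<in> Vand n (s i) \<and>
               B i \<in> VandT n (s i) \<and> B' i \<in> VandT n (s i) \<and>
               D i \<in> VandT n (s i) \<and> D' i \<in> VandT n (s i)) \<and>
        E \<in> carrier_mat n n \<and> diagonal_mat E \<and>
        M = alt_prod n B A * alt_prod n B' A' * E * alt_prod n D C * alt_prod n D' C'))"
proof -
  interpret residue_system n s
  proof
    show "0 < n" using assms(1) by simp
    show "i = j" if "i < n" "j < n" "int n dvd s i - s j" for i j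
      using assms(2)[OF that(1,2)] that(3) by (auto simp: cong_iff_dvd_diff)
  qed
  have "\<kappa> \<noteq> 0 \<or> 2 \<le> n"
  proof (cases "n = 1")
    case True
    then have "\<kappa> = of_int (\<Sum>i<n. s i)" using \<kappa>_eq by simp
    then show ?thesis using assms(3) by (metis of_int_eq_0_iff)
  qed (use assms(1) in auto)
  from vand_image_contains_generic[OF vand_image_curve[OF this]]
  obtain f X0 where f: "f \<in> polyfuns" "f (entries n X0) \<noteq> 0"
    "\<forall>X \<in> carrier_mat n n. f (entries n X) \<noteq> 0 \<longrightarrow> X \<in> vand_image n s"
    by (elim bexE conjE exE)
  note products = invertible_vand_products[OF f]
  show ?thesis
  proof (intro conjI ballI impI)
    fix M :: "complex mat" assume M: "M \<in> carrier_mat n n" "invertible_mat M"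
    then have "det M \<noteq> 0" using invertible_mat_iff_det by blast
    from products[OF M(1) this] show "\<exists>A A' B B'. (\<forall>i<n. A i \<in> Vand n (s i) \<and> A' i \<in> Vand n (s i) \<and>
               B i \<in> VandT n (s i) \<and> B' i \<in> VandT n (s i)) \<and>
        M = alt_prod n B A * alt_prod n B' A'"
      by (elim exE conjE) (intro exI conjI)
  next
    fix M :: "complex mat" assume M: "M \<in> carrier_mat n n"
    obtain E where E: "E \<in> carrier_mat n n" "diagonal_mat E" "equiv_mat n M E"
      using equiv_mat_diagonal[OF M] by blast
    obtain P Q where PQ: "P \<in> carrier_mat n n" "Q \<in> carrier_mat n n" "det P \<noteq> 0" "det Q \<noteq> 0" "M = P * E * Q"
      using E(3) unfolding equiv_mat_def by blast
    obtain A A' B B' where P: "\<forall>i<n. A i \<in> Vand n (s i) \<and> A' i \<in> Vand n (s i) \<and>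
               B i \<in> VandT n (s i) \<and> B' i \<in> VandT n (s i)"
        "P = alt_prod n B A * alt_prod n B' A'"
      using products[OF PQ(1,3)] by (elim exE conjE) (rule that)
    obtain C C' D D' where Q: "\<forall>i<n. C i \<in> Vand n (s i) \<and> C' i \<in> Vand n (s i) \<and>
               D i \<in> VandT n (s i) \<and> D' i \<in> VandT n (s i)"
        "Q = alt_prod n D C * alt_prod n D' C'" "alt_prod n D C \<in> carrier_mat n n" "alt_prod n D' C' \<in> carrier_mat n n"
      using products[OF PQ(2,4)] by (elim exE conjE) (rule that)
    have "M = P * E * (alt_prod n D C * alt_prod n D' C')" using PQ(5) unfolding Q(2) .
    also have "\<dots> = P * E * alt_prod n D C * alt_prod n D' C'"
      by (rule assoc_mult_mat[OF mult_carrier_mat[OF PQ(1) E(1)] Q(3,4), symmetric])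
    finally have M_eq: "M = alt_prod n B A * alt_prod n B' A' * E * alt_prod n D C * alt_prod n D' C'"
      unfolding P(2) .
    have "\<forall>i<n. A i \<in> Vand n (s i) \<and> A' i \<in> Vand n (s i) \<and>
               C i \<in> Vand n (s i) \<and> C' i \<in> Vand n (s i) \<and>
               B i \<in> VandT n (s i) \<and> B' i \<in> VandT n (s i) \<and>
               D i \<in> VandT n (s i) \<and> D' i \<in> VandT n (s i)"
      using P(1) Q(1) by blast
    from conjI[OF this conjI[OF E(1) conjI[OF E(2) M_eq]]]
    show "\<exists>A A' C C' B B' D D' E.
        (\<forall>i<n. A i \<in> Vand n (s i) \<and> A' i \<in> Vand n (s i) \<and>
               C i \<in> Vand n (s i) \<and> C' i \<in> Vand n (s i) \<and>
               B i \<in> VandT n (s i) \<and> B' i \<in> VandT n (s i) \<and>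
               D i \<in> VandT n (s i) \<and> D' i \<in> VandT n (s i)) \<and>
        E \<in> carrier_mat n n \<and> diagonal_mat E \<and>
        M = alt_prod n B A * alt_prod n B' A' * E * alt_prod n D C * alt_prod n D' C'"
      by (intro exI)
  qed
qed

end
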